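(* Let $n\geq 2$ and let $P\subseteq\mathbb{R}^n$ be an $n$-dimensional lattice simplex. Then $c(P)\geq 0$.
   Context: A lattice simplex in $\mathbb{R}^n$ of dimension $n$ is the convex hull of $n+1$ affinely independent points of $\mathbb{Z}^n$. For an $n$-dimensional lattice polytope $P$, $\mathcal{F}(P)_j$ denotes the set of $j$-dimensional faces of $P$ ($P$ itself being the only $n$-dimensional face), and $c(P)=\sum_{j=0}^n(-1)^{n-j}(j+1)\sum_{F\in\mathcal{F}(P)_j}\mathrm{Vol}_{\mathbb{Z}}(F)$, where $\mathrm{Vol}_{\mathbb{Z}}(F)$ is the volume on the affine span $\mathrm{aff}(F)$ normalized so that a fundamental parallelepiped of $\mathrm{aff}(F)\cap\mathbb{Z}^n$ has volume $\dim(F)!$. *)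

theory Defs
  imports "HOL-Analysis.Analysis"
begin

definition integer_points :: "(real ^ 'n) set" where
  "integer_points = {x. \<forall>i. x $ i \<in> \<int>}"

definition lattice_simplex :: "(real ^ 'n) set \<Rightarrow> bool" where
  "lattice_simplex P \<longleftrightarrow>
     (\<exists>V. V \<subseteq> integer_points \<and> \<not> affine_dependent V \<and>
          card V = CARD('n) + 1 \<and> P = convex hull V)"

definition faces_of_dim :: "'a::euclidean_space set \<Rightarrow> nat \<Rightarrow> 'a set set" where
  "faces_of_dim P j = {F. F face_of P \<and> aff_dim F = int j}"

definition affine_param ::
  "nat \<Rightarrow> 'a::euclidean_space \<Rightarrow> (nat \<Rightarrow> 'a) \<Rightarrow> (nat \<Rightarrow> real) \<Rightarrow> 'a" where
  "affine_param d p b t = p + (\<Sum>i<d. t i *\<^sub>R b i)"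

definition affine_lattice_basis ::
  "'a::euclidean_space set \<Rightarrow> nat \<Rightarrow> 'a \<Rightarrow> (nat \<Rightarrow> 'a) \<Rightarrow> bool" where
  "affine_lattice_basis L d p b \<longleftrightarrow>
     inj_on b {..<d} \<and> independent (b ` {..<d}) \<and>
     L = {affine_param d p b (\<lambda>i. real_of_int (a i)) | a :: nat \<Rightarrow> int. True}"

definition fundamental_parallelepiped ::
  "nat \<Rightarrow> 'a::euclidean_space \<Rightarrow> (nat \<Rightarrow> 'a) \<Rightarrow> 'a set" where
  "fundamental_parallelepiped d p b = affine_param d p b ` {t. \<forall>i<d. 0 \<le> t i \<and> t i \<le> 1}"

text \<open>
  The translation-invariant measure on the affine subspace through \<open>p\<close> with directions
  \<open>b 0, \<dots>, b (d - 1)\<close> that gives the parallelepiped spanned by these directions measure 1: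
  the image of \<open>d\<close>-dimensional Lebesgue measure under the affine parametrisation.
  For \<open>d = 0\<close> it is the unit point mass at \<open>p\<close>.
\<close>

definition affine_lebesgue ::
  "nat \<Rightarrow> 'a::euclidean_space \<Rightarrow> (nat \<Rightarrow> 'a) \<Rightarrow> 'a measure" where
  "affine_lebesgue d p b = distr (Pi\<^sub>M {..<d} (\<lambda>_. lborel)) borel (affine_param d p b)"

lemma affine_param_measurable:
  "affine_param d p b \<in> borel_measurable (Pi\<^sub>M {..<d} (\<lambda>_. lborel))"
  unfolding affine_param_def by measurable

lemma measure_fundamental_parallelepiped:
  assumes inj: "inj_on b {..<d}" and ind: "independent (b ` {..<d})"
  shows "measure (affine_lebesgue d p b) (fundamental_parallelepiped d p b) = 1"
proof -
  interpret product_sigma_finite "\<lambda>_::nat. lborel :: real measure" by standard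
  let ?M = "Pi\<^sub>M {..<d} (\<lambda>_. lborel :: real measure)"
  let ?f = "affine_param d p b"
  have compact: "compact (fundamental_parallelepiped d p b)"
  proof -
    have "compact ((\<lambda>t. \<Sum>i<k. t i *\<^sub>R b i) ` {t. \<forall>i<k. 0 \<le> t i \<and> t i \<le> (1::real)})" for k
    proof (induction k)
      case 0
      have "((\<lambda>t. \<Sum>i<0. t i *\<^sub>R b i) ` {t::nat \<Rightarrow> real. \<forall>i<0. 0 \<le> t i \<and> t i \<le> 1}) = {0}"
        by auto
      then show ?case by simp
    next
      case (Suc k)
      let ?S = "(\<lambda>t. \<Sum>i<k. t i *\<^sub>R b i) ` {t. \<forall>i<k. 0 \<le> t i \<and> t i \<le> (1::real)}"
      let ?R = "(\<lambda>t. \<Sum>i<Suc k. t i *\<^sub>R b i) ` {t. \<forall>i<Suc k. 0 \<le> t i \<and> t i \<le> (1::real)}"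
      let ?T = "(\<lambda>s. s *\<^sub>R b k) ` {0..1::real}"
      have T: "compact ?T" by (intro compact_continuous_image continuous_intros) auto
      have "?R = {x + y | x y. x \<in> ?S \<and> y \<in> ?T}"
      proof (intro subset_antisym subsetI)
        fix z assume "z \<in> ?R"
        then show "z \<in> {x + y | x y. x \<in> ?S \<and> y \<in> ?T}" by fastforce
      next
        fix z assume "z \<in> {x + y | x y. x \<in> ?S \<and> y \<in> ?T}"
        then obtain t s where t: "\<forall>i<k. 0 \<le> t i \<and> t i \<le> (1::real)" and s: "0 \<le> s" "s \<le> 1"
          and z: "z = (\<Sum>i<k. t i *\<^sub>R b i) + s *\<^sub>R b k" by auto
        have "z = (\<Sum>i<Suc k. (t(k := s)) i *\<^sub>R b i)" using z by simp
        then show "z \<in> ?R" using t s by (intro image_eqI[where x="t(k := s)"]) auto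
      qed
      then show ?case using compact_sums[OF Suc.IH T] by simp
    qed
    from compact_translation[OF this[of d], of p] show ?thesis
      by (simp add: fundamental_parallelepiped_def affine_param_def image_image)
  qed
  have uniq: "t i = s i" if eq: "?f t = ?f s" and i: "i < d" for t s i
  proof -
    have "(\<Sum>i<d. (t i - s i) *\<^sub>R b i) = 0"
      using eq by (simp add: affine_param_def scaleR_diff_left sum_subtractf)
    then have "(\<Sum>v\<in>b ` {..<d}. (t (the_inv_into {..<d} b v) - s (the_inv_into {..<d} b v)) *\<^sub>R v) = 0"
      by (subst sum.reindex[OF inj]) (simp add: the_inv_into_f_f[OF inj])
    then have "t (the_inv_into {..<d} b (b i)) - s (the_inv_into {..<d} b (b i)) = 0"
      using i by (intro independentD[OF ind, where t="b ` {..<d}"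
          and u="\<lambda>v. t (the_inv_into {..<d} b v) - s (the_inv_into {..<d} b v)"]) auto
    then show ?thesis using i by (simp add: the_inv_into_f_f[OF inj])
  qed
  have "?f -` fundamental_parallelepiped d p b \<inter> space ?M = Pi\<^sub>E {..<d} (\<lambda>_. {0..1})"
    using uniq
    by (auto simp: fundamental_parallelepiped_def space_PiM PiE_iff) force+
  moreover have "emeasure (affine_lebesgue d p b) (fundamental_parallelepiped d p b) =
      emeasure ?M (?f -` fundamental_parallelepiped d p b \<inter> space ?M)"
    unfolding affine_lebesgue_def
    by (intro emeasure_distr affine_param_measurable) (simp add: borel_compact[OF compact])
  moreover have "emeasure ?M (Pi\<^sub>E {..<d} (\<lambda>_. {0..1})) = 1"
    by (subst emeasure_PiM) auto
  ultimately show ?thesis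
    by (simp add: measure_def)
qed

text \<open>
  The normalised volume does not depend on the choice of the affine lattice basis, since two bases
  of the same affine lattice differ by an integral translation and a unimodular matrix.  A basis
  exists whenever the affine hull of \<open>F\<close> is spanned by integer points, in particular for every
  nonempty face of a lattice polytope.
\<close>

definition lattice_volume :: "(real ^ 'n) set \<Rightarrow> real" where
  "lattice_volume F =
     (let d = nat (aff_dim F);
          (p, b) = (SOME (p, b). affine_lattice_basis (affine hull F \<inter> integer_points) d p b)
      in fact d * measure (affine_lebesgue d p b) F)"

definition c_invariant :: "(real ^ 'n) set \<Rightarrow> real" where
  "c_invariant P =
     (let n = nat (aff_dim P)
      in \<Sum>j=0..n. (-1) ^ (n - j) * real (j + 1) * (\<Sum>F\<in>faces_of_dim P j. lattice_volume F))"

lemma aff_dim_lattice_simplex: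
  fixes P :: "(real ^ 'n) set"
  assumes "lattice_simplex P"
  shows "aff_dim P = int CARD('n)"
proof -
  obtain V where V: "\<not> affine_dependent V" "card V = CARD('n) + 1" "P = convex hull V"
    using assms by (auto simp: lattice_simplex_def)
  then show ?thesis
    using aff_dim_affine_independent[of V] by (simp add: aff_dim_convex_hull)
qed

end

(*
  Write (v, 1) for the homogenisation of a vertex v. The normalised volume of a face with vertex set c
  is the number of integer points in the half-open parallelepiped spanned by the vectors (v, 1),
  v in c, that is, the number of those points u of the parallelepiped of the whole simplex whose
  support lies in c. After exchanging the two summations, c(P) becomes the sum, over the integer
  points u of the half-open parallelepiped of P, of the numbers
    sum over c with supp u <= c <= V of (-1)^(|V| - |c|) |c|,
  which are |V| if supp u = V, 1 if supp u misses one vertex, and 0 otherwise.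
*)
theory Submission
  imports Defs
begin

section \<open>Linear combinations of finite families\<close>

text \<open>The lattice point count is where the work lies. \<open>lattice_volume\<close> measures a
  face in an unspecified lattice basis, whereas the count refers to the edge vectors at a vertex
  \<open>v0\<close>, which may span only a proper sublattice. Passing from edge coordinates to
  lattice coordinates multiplies Lebesgue measure by the index of that sublattice. This factor is
  never computed as a determinant: an affine change of coordinates scales all measurable sets by one
  constant, the half-open unit cube in edge coordinates reveals the constant as a number of lattice
  points, and the standard simplex, of measure 1/d!, then yields the normalised volume. The
  homogenised vectors (v, 1) do not occur literally. Since the coefficients of a point sum to an
  integer, the one at \<open>v0\<close> is determined modulo 1 by the others, so edge coordinates
  lose nothing.\<close>

definition lincomb :: "nat \<Rightarrow> (nat \<Rightarrow> 'a::real_vector) \<Rightarrow> (nat \<Rightarrow> real) \<Rightarrow> 'a" where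
  "lincomb d b t = (\<Sum>i<d. t i *\<^sub>R b i)"

definition lin_indep :: "nat \<Rightarrow> (nat \<Rightarrow> 'a::real_vector) \<Rightarrow> bool" where
  "lin_indep d b \<longleftrightarrow> (\<forall>t. lincomb d b t = 0 \<longrightarrow> (\<forall>i<d. t i = 0))"

lemma lincomb_add: "lincomb d b (\<lambda>i. s i + t i) = lincomb d b s + lincomb d b t"
  by (simp add: lincomb_def scaleR_add_left sum.distrib)

lemma lincomb_diff: "lincomb d b (\<lambda>i. s i - t i) = lincomb d b s - lincomb d b t"
  by (simp add: lincomb_def scaleR_diff_left sum_subtractf)

lemma lincomb_scale: "lincomb d b (\<lambda>i. c * t i) = c *\<^sub>R lincomb d b t"
  by (simp add: lincomb_def scaleR_sum_right)

lemma lincomb_zero [simp]: "lincomb d b (\<lambda>i. 0) = 0"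
  by (simp add: lincomb_def)

lemma lincomb_Suc: "lincomb (Suc d) b t = lincomb d b t + t d *\<^sub>R b d"
  by (simp add: lincomb_def)

lemma lincomb_cong:
  "(\<And>i. i < d \<Longrightarrow> b i = b' i) \<Longrightarrow> (\<And>i. i < d \<Longrightarrow> t i = t' i) \<Longrightarrow> lincomb d b t = lincomb d b' t'"
  by (simp add: lincomb_def)

lemma lincomb_unit:
  assumes "i < d"
  shows "lincomb d b (\<lambda>j. if j = i then 1 else 0) = b i"
proof -
  have "lincomb d b (\<lambda>j. if j = i then 1 else 0) = (\<Sum>j<d. if j = i then b j else 0)"
    unfolding lincomb_def by (intro sum.cong) auto
  then show ?thesis using assms by simp
qed

lemma lincomb_lincomb:
  "lincomb d (\<lambda>i. lincomb e b (c i)) t = lincomb e b (\<lambda>j. \<Sum>i<d. t i * c i j)"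
proof -
  have "lincomb d (\<lambda>i. lincomb e b (c i)) t = (\<Sum>i<d. \<Sum>j<e. (t i * c i j) *\<^sub>R b j)"
    by (simp add: lincomb_def scaleR_sum_right)
  also have "\<dots> = (\<Sum>j<e. \<Sum>i<d. (t i * c i j) *\<^sub>R b j)"
    by (rule sum.swap)
  also have "\<dots> = lincomb e b (\<lambda>j. \<Sum>i<d. t i * c i j)"
    by (simp add: lincomb_def scaleR_sum_left)
  finally show ?thesis .
qed

lemma lin_indepD:
  assumes "lin_indep d b" "lincomb d b s = lincomb d b t" "i < d"
  shows "s i = t i"
  using assms lincomb_diff[of d b s t] by (auto simp: lin_indep_def)

text \<open>A repeated vector is a dependence of the family but invisible to its image set, hence
  the injectivity.\<close>

lemma lin_indep_iff_independent:
  "lin_indep d b \<longleftrightarrow> inj_on b {..<d} \<and> independent (b ` {..<d})"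
proof
  assume b: "lin_indep d b"
  have inj: "inj_on b {..<d}"
  proof (rule inj_onI)
    fix i j assume ij: "i \<in> {..<d}" "j \<in> {..<d}" "b i = b j"
    have "lincomb d b (\<lambda>l. if l = i then 1 else 0) = lincomb d b (\<lambda>l. if l = j then 1 else 0)"
      using ij by (simp add: lincomb_unit)
    from lin_indepD[OF b this, of i] ij show "i = j" by (auto split: if_splits)
  qed
  have "independent (b ` {..<d})"
  proof (rule independent_if_scalars_zero)
    fix u x assume u: "(\<Sum>v\<in>b ` {..<d}. u v *\<^sub>R v) = 0" and "x \<in> b ` {..<d}"
    then obtain i where i: "i < d" "x = b i" by auto
    have "lincomb d b (\<lambda>i. u (b i)) = 0"
      using u by (simp add: lincomb_def sum.reindex[OF inj])
    then show "u x = 0" using b i by (auto simp: lin_indep_def)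
  qed simp
  with inj show "inj_on b {..<d} \<and> independent (b ` {..<d})" by simp
next
  assume "inj_on b {..<d} \<and> independent (b ` {..<d})"
  then have inj: "inj_on b {..<d}" and ind: "independent (b ` {..<d})" by auto
  show "lin_indep d b"
    unfolding lin_indep_def
  proof (intro allI impI)
    fix t i assume t: "lincomb d b t = 0" and i: "i < d"
    have "(\<Sum>v\<in>b ` {..<d}. t (the_inv_into {..<d} b v) *\<^sub>R v) = 0"
      using t by (simp add: lincomb_def sum.reindex[OF inj] the_inv_into_f_f[OF inj])
    then have "t (the_inv_into {..<d} b (b i)) = 0"
      using i by (intro independentD[OF ind, where t = "b ` {..<d}"
          and u = "\<lambda>v. t (the_inv_into {..<d} b v)"]) auto
    then show "t i = 0" using i by (simp add: the_inv_into_f_f[OF inj])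
  qed
qed

lemma span_image_lessThan: "span (b ` {..<d}) = range (lincomb d b)"
proof (rule span_unique)
  show "b ` {..<d} \<subseteq> range (lincomb d b)"
    using lincomb_unit by (metis image_subsetI lessThan_iff rangeI)
  show "subspace (range (lincomb d b))"
    unfolding subspace_def
    by (auto simp flip: lincomb_add lincomb_scale intro: range_eqI[where x = "\<lambda>_. 0"])
  show "range (lincomb d b) \<subseteq> T" if "b ` {..<d} \<subseteq> T" "subspace T" for T
    using that by (auto simp: lincomb_def intro!: subspace_sum subspace_scale)
qed

lemma range_lincomb_subset:
  assumes "\<And>i. i < d \<Longrightarrow> b i \<in> range (lincomb e w)"
  shows "range (lincomb d b) \<subseteq> range (lincomb e w)"
  using assms span_mono span_minimal[of "b ` {..<d}" "range (lincomb e w)"]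
  by (metis image_subsetI lessThan_iff span_image_lessThan subspace_span)

section \<open>Integer points and lattice bases\<close>

lemma integer_points_zero [simp]: "0 \<in> integer_points"
  by (simp add: integer_points_def)

lemma integer_points_add: "x \<in> integer_points \<Longrightarrow> y \<in> integer_points \<Longrightarrow> x + y \<in> integer_points"
  by (simp add: integer_points_def)

lemma integer_points_diff: "x \<in> integer_points \<Longrightarrow> y \<in> integer_points \<Longrightarrow> x - y \<in> integer_points"
  by (simp add: integer_points_def)

lemma integer_points_scale: "a \<in> \<int> \<Longrightarrow> x \<in> integer_points \<Longrightarrow> a *\<^sub>R x \<in> integer_points"
  by (simp add: integer_points_def)

lemma integer_points_sum: "(\<And>i. i \<in> I \<Longrightarrow> f i \<in> integer_points) \<Longrightarrow> sum f I \<in> integer_points"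
  by (auto simp: integer_points_def intro!: Ints_sum)

lemma integer_points_lincomb:
  "(\<And>i. i < d \<Longrightarrow> t i \<in> \<int>) \<Longrightarrow> (\<And>i. i < d \<Longrightarrow> b i \<in> integer_points) \<Longrightarrow> lincomb d b t \<in> integer_points"
  unfolding lincomb_def by (intro integer_points_sum integer_points_scale) auto

lemma finite_bounded_integer_points:
  fixes A :: "(real ^ 'n) set"
  assumes "bounded A"
  shows "finite (A \<inter> integer_points)"
proof -
  obtain B where B: "\<And>x. x \<in> A \<Longrightarrow> norm x \<le> B"
    using assms by (auto simp: bounded_iff)
  let ?f = "\<lambda>x::real^'n. \<lambda>i. \<lfloor>x $ i\<rfloor>"
  let ?S = "{-\<lceil>B\<rceil>..\<lceil>B\<rceil>}"
  have "?f ` (A \<inter> integer_points) \<subseteq> PiE UNIV (\<lambda>_. ?S)"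
  proof (intro image_subsetI PiE_I)
    fix x i assume "x \<in> A \<inter> integer_points"
    then have "\<bar>x $ i\<bar> \<le> B" using B component_le_norm_cart[of x i] by force
    then have "- \<lceil>B\<rceil> \<le> \<lfloor>x $ i\<rfloor> \<and> \<lfloor>x $ i\<rfloor> \<le> \<lceil>B\<rceil>"
      by linarith
    then show "\<lfloor>x $ i\<rfloor> \<in> ?S" by simp
  qed simp
  moreover have "finite (PiE (UNIV :: 'n set) (\<lambda>_. ?S))"
    by (intro finite_PiE) auto
  moreover have "inj_on ?f (A \<inter> integer_points)"
  proof (rule inj_onI)
    fix x y assume x: "x \<in> A \<inter> integer_points" and y: "y \<in> A \<inter> integer_points"
      and eq: "?f x = ?f y"
    show "x = y"
      unfolding vec_eq_iff
    proof
      fix i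
      have "\<lfloor>x $ i\<rfloor> = \<lfloor>y $ i\<rfloor>" using eq by meson
      moreover have "x $ i \<in> \<int>" "y $ i \<in> \<int>" using x y by (auto simp: integer_points_def)
      ultimately show "x $ i = y $ i" by (metis of_int_floor)
    qed
  qed
  ultimately show ?thesis by (metis finite_subset inj_on_finite)
qed

text \<open>The bounds are closed so that one statement serves both the half-open boxes and the
  candidates in the basis construction below, whose last coordinate may equal 1.\<close>

lemma finite_parallelepiped_integer_points:
  fixes w :: "nat \<Rightarrow> real ^ 'n"
  shows "finite {x \<in> integer_points. \<exists>t. x = lincomb d w t \<and> (\<forall>i<d. 0 \<le> t i \<and> t i \<le> 1)}"
proof -
  have "bounded {lincomb d w t | t. \<forall>i<d. 0 \<le> t i \<and> t i \<le> 1}"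
  proof (rule boundedI[where B = "\<Sum>i<d. norm (w i)"], clarify)
    fix t :: "nat \<Rightarrow> real" assume t: "\<forall>i<d. 0 \<le> t i \<and> t i \<le> 1"
    have "norm (t i *\<^sub>R w i) \<le> norm (w i)" if "i < d" for i
      using t that by (simp add: mult_left_le_one_le)
    then have "(\<Sum>i<d. norm (t i *\<^sub>R w i)) \<le> (\<Sum>i<d. norm (w i))"
      by (intro sum_mono) simp
    then show "norm (lincomb d w t) \<le> (\<Sum>i<d. norm (w i))"
      unfolding lincomb_def by (rule order_trans[OF norm_sum])
  qed
  then have "finite ({lincomb d w t | t. \<forall>i<d. 0 \<le> t i \<and> t i \<le> 1} \<inter> integer_points)"
    by (rule finite_bounded_integer_points)
  moreover have "{x \<in> integer_points. \<exists>t. x = lincomb d w t \<and> (\<forall>i<d. 0 \<le> t i \<and> t i \<le> 1)} =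
      {lincomb d w t | t. \<forall>i<d. 0 \<le> t i \<and> t i \<le> 1} \<inter> integer_points"
    by blast
  ultimately show ?thesis by (simp only:)
qed

text \<open>Needed so that \<open>SOME\<close> in \<open>lattice_volume\<close> really picks a
  basis. The induction succeeds because an integer point of the larger span with coordinate 0 along
  \<open>w k\<close> already lies in the smaller span, where the hypothesis supplies integral
  coefficients.\<close>

lemma lattice_basis_exists:
  fixes w :: "nat \<Rightarrow> real ^ 'n"
  assumes "lin_indep d w" "\<And>i. i < d \<Longrightarrow> w i \<in> integer_points"
  shows "\<exists>b. lin_indep d b \<and> (\<forall>i<d. b i \<in> integer_points) \<and>
    range (lincomb d b) = range (lincomb d w) \<and>
    (\<forall>x \<in> range (lincomb d w) \<inter> integer_points. \<exists>a::nat \<Rightarrow> int. x = lincomb d b (\<lambda>i. of_int (a i)))"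
  using assms
proof (induction d)
  case 0
  show ?case by (auto simp: lin_indep_def lincomb_def)
next
  case (Suc k)
  have "lin_indep k w"
    unfolding lin_indep_def
  proof (intro allI impI)
    fix t i assume "lincomb k w t = 0" "i < k"
    moreover have "lincomb (Suc k) w (t(k := 0)) = lincomb k w t"
      by (simp add: lincomb_Suc cong: lincomb_cong)
    ultimately show "t i = 0"
      using Suc.prems(1) unfolding lin_indep_def by (metis fun_upd_other less_SucI nat_neq_iff)
  qed
  with Suc obtain b where b: "lin_indep k b" "\<And>i. i < k \<Longrightarrow> b i \<in> integer_points"
    "range (lincomb k b) = range (lincomb k w)"
    "\<And>x. x \<in> range (lincomb k w) \<Longrightarrow> x \<in> integer_points \<Longrightarrow>
       \<exists>a::nat \<Rightarrow> int. x = lincomb k b (\<lambda>i. of_int (a i))"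
    by (metis IntI less_SucI)
  have wk: "w k \<in> integer_points" using Suc.prems by simp
  have zero: "c = 0" if eq: "lincomb k b t + c *\<^sub>R w k = 0" for t c
  proof -
    obtain s where "lincomb k b t = lincomb k w s" using b(3) by (metis rangeE rangeI)
    then have "lincomb (Suc k) w (s(k := c)) = 0"
      using eq by (simp add: lincomb_Suc cong: lincomb_cong)
    then show ?thesis using Suc.prems(1) unfolding lin_indep_def by (metis fun_upd_same lessI)
  qed
  have uniq: "c = c'" if "lincomb k b t + c *\<^sub>R w k = lincomb k b t' + c' *\<^sub>R w k" for t t' c c'
    using zero[of "\<lambda>i. t i - t' i" "c - c'"] that
    by (simp add: lincomb_diff scaleR_diff_left algebra_simps)
  have range_Suc: "x \<in> range (lincomb (Suc k) w) \<longleftrightarrow> (\<exists>t c. x = lincomb k b t + c *\<^sub>R w k)" for x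
  proof
    assume "x \<in> range (lincomb (Suc k) w)"
    then obtain t where "x = lincomb (Suc k) w t" by auto
    moreover obtain s where "lincomb k w t = lincomb k b s" using b(3) by (metis rangeE rangeI)
    ultimately show "\<exists>t c. x = lincomb k b t + c *\<^sub>R w k" by (auto simp: lincomb_Suc)
  next
    assume "\<exists>t c. x = lincomb k b t + c *\<^sub>R w k"
    then obtain t c where x: "x = lincomb k b t + c *\<^sub>R w k" by auto
    moreover obtain s where "lincomb k b t = lincomb k w s" using b(3) by (metis rangeE rangeI)
    ultimately have "x = lincomb (Suc k) w (s(k := c))" by (simp add: lincomb_Suc cong: lincomb_cong)
    then show "x \<in> range (lincomb (Suc k) w)" by simp
  qed
  \<comment> \<open>The last basis vector is a lattice point of least positive coordinate along \<open>w k\<close>;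
    the minimum exists because reduction modulo the basis found so far leaves finitely many candidates.\<close>
  define X where "X = {x \<in> integer_points. \<exists>t c. x = lincomb k b t + c *\<^sub>R w k \<and>
    (\<forall>i<k. 0 \<le> t i \<and> t i \<le> 1) \<and> 0 < c \<and> c \<le> 1}"
  define f where "f x = (THE c. \<exists>t. x = lincomb k b t + c *\<^sub>R w k)" for x
  have f: "f (lincomb k b t + c *\<^sub>R w k) = c" for t c
    unfolding f_def by (rule the_equality) (use uniq in \<open>blast, metis\<close>)
  have "finite X"
  proof (rule finite_subset[OF _ finite_parallelepiped_integer_points[of "Suc k" "b(k := w k)"]], clarsimp simp: X_def)
    fix t :: "nat \<Rightarrow> real" and c assume t: "\<forall>i<k. 0 \<le> t i \<and> t i \<le> 1" and c: "0 < c" "c \<le> (1::real)"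
    show "\<exists>t'. lincomb k b t + c *\<^sub>R w k = lincomb (Suc k) (b(k := w k)) t' \<and>
      (\<forall>i<Suc k. 0 \<le> t' i \<and> t' i \<le> 1)"
      using t c by (intro exI[of _ "t(k := c)"]) (auto simp: lincomb_Suc less_Suc_eq cong: lincomb_cong)
  qed
  \<comment> \<open>The bound \<open>c \<le> 1\<close> in \<open>X\<close> is chosen so that
    \<open>w k\<close>, with coordinate 1, is still a candidate and the minimum is taken over a
    nonempty set.\<close>
  moreover have "w k \<in> X"
    using wk unfolding X_def by (auto intro!: exI[of _ "\<lambda>_. 0"] exI[of _ "1::real"])
  ultimately have "is_arg_min f (\<lambda>x. x \<in> X) (arg_min_on f X)"
    using arg_min_if_finite[of X f] by (auto simp: is_arg_min_def)
  then obtain x0 where x0: "x0 \<in> X" and min: "\<And>x. x \<in> X \<Longrightarrow> f x0 \<le> f x"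
    by (auto simp: is_arg_min_linorder)
  then obtain t0 c0 where x0_eq: "x0 = lincomb k b t0 + c0 *\<^sub>R w k" and c0: "0 < c0" "c0 \<le> 1"
    and x0_int: "x0 \<in> integer_points"
    by (auto simp: X_def)
  let ?b = "b(k := x0)"
  have lc: "lincomb (Suc k) ?b t = lincomb k b (\<lambda>i. t i + t k * t0 i) + (t k * c0) *\<^sub>R w k" for t
    by (simp add: lincomb_Suc lincomb_add lincomb_scale x0_eq scaleR_add_right cong: lincomb_cong)
  have indep: "lin_indep (Suc k) ?b"
    unfolding lin_indep_def
  proof (intro allI impI)
    fix t i assume t: "lincomb (Suc k) ?b t = 0" and i: "i < Suc k"
    then have "t k = 0" using zero c0 unfolding lc by (metis less_irrefl mult_eq_0_iff)
    with t have "lincomb k b t = 0" by (simp add: lc)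
    with \<open>t k = 0\<close> b(1) i show "t i = 0" by (auto simp: lin_indep_def less_Suc_eq)
  qed
  have rng: "range (lincomb (Suc k) ?b) = range (lincomb (Suc k) w)"
  proof (intro equalityI subsetI)
    fix x assume "x \<in> range (lincomb (Suc k) ?b)"
    then obtain t where "x = lincomb (Suc k) ?b t" by auto
    then show "x \<in> range (lincomb (Suc k) w)" unfolding range_Suc lc by blast
  next
    fix x assume "x \<in> range (lincomb (Suc k) w)"
    then obtain t c where x: "x = lincomb k b t + c *\<^sub>R w k" unfolding range_Suc by blast
    have "x = lincomb (Suc k) ?b ((\<lambda>i. t i - c / c0 * t0 i)(k := c / c0))"
      unfolding lc x using c0 by (simp cong: lincomb_cong)
    then show "x \<in> range (lincomb (Suc k) ?b)" by blast
  qed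
  have lattice: "\<exists>a::nat \<Rightarrow> int. x = lincomb (Suc k) ?b (\<lambda>i. of_int (a i))"
    if x: "x \<in> range (lincomb (Suc k) w)" "x \<in> integer_points" for x
  proof -
    obtain t c where x_eq: "x = lincomb k b t + c *\<^sub>R w k" using x(1) unfolding range_Suc by blast
    \<comment> \<open>Division with remainder by the minimal coordinate: \<open>x - m x0\<close> has
      coordinate \<open>c1\<close> in [0, c0) along \<open>w k\<close>.\<close>
    define m where "m = \<lfloor>c / c0\<rfloor>"
    define c1 where "c1 = c - of_int m * c0"
    define t1 where "t1 i = t i - of_int m * t0 i" for i
    have c1: "0 \<le> c1" "c1 < c0"
    proof -
      have "of_int m \<le> c / c0" "c / c0 < of_int m + 1" unfolding m_def by linarith+
      then show "0 \<le> c1" "c1 < c0" using c0 by (auto simp: c1_def field_simps)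
    qed
    define x1 where "x1 = x - of_int m *\<^sub>R x0"
    have x1: "x1 = lincomb k b t1 + c1 *\<^sub>R w k"
      unfolding x1_def x_eq x0_eq t1_def c1_def by (simp add: lincomb_diff lincomb_scale algebra_simps)
    have x1_int: "x1 \<in> integer_points"
      unfolding x1_def using x(2) x0_int by (simp add: integer_points_diff integer_points_scale)
    \<comment> \<open>Dropping the integral parts of the other coefficients brings the point into
      the box of \<open>X\<close> without changing \<open>c1\<close>; a positive \<open>c1\<close>
      would then contradict the minimality of \<open>c0\<close>.\<close>
    define x2 where "x2 = x1 - lincomb k b (\<lambda>i. of_int \<lfloor>t1 i\<rfloor>)"
    have x2: "x2 = lincomb k b (\<lambda>i. frac (t1 i)) + c1 *\<^sub>R w k"
      unfolding x2_def x1 frac_def lincomb_diff by simp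
    have x2_int: "x2 \<in> integer_points"
      unfolding x2_def using x1_int b(2) by (simp add: integer_points_diff integer_points_lincomb)
    have "c1 = 0"
    proof (rule ccontr)
      assume "c1 \<noteq> 0"
      then have "x2 \<in> X"
        unfolding X_def using c1 c0 x2 x2_int frac_lt_1[THEN less_imp_le] by (fastforce simp: frac_ge_0)
      from min[OF this] have "c0 \<le> c1" unfolding x2 x0_eq f .
      with c1 show False by simp
    qed
    then have "x1 \<in> range (lincomb k w)" using x1 b(3) by auto
    from b(4)[OF this x1_int] obtain a :: "nat \<Rightarrow> int" where a: "x1 = lincomb k b (\<lambda>i. of_int (a i))" ..
    have "x = lincomb (Suc k) ?b (\<lambda>i. of_int ((a(k := m)) i))"
      using a unfolding x1_def by (simp add: lincomb_Suc algebra_simps cong: lincomb_cong)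
    then show ?thesis by blast
  qed
  from b(2) x0_int have "\<forall>i<Suc k. ?b i \<in> integer_points" by (simp add: less_Suc_eq)
  with indep rng lattice show ?case by blast
qed

section \<open>Alternating sums over supersets\<close>

text \<open>Toggling the membership of \<open>x\<close> preserves both inclusions; the cancellations
  below all happen inside the pairs \<open>c\<close>, \<open>insert x c\<close>.\<close>

lemma sum_supersets_pair:
  fixes g :: "'a set \<Rightarrow> 'b::comm_monoid_add"
  assumes "finite V" "x \<in> V" "x \<notin> A"
  shows "(\<Sum>c | A \<subseteq> c \<and> c \<subseteq> V. g c) = (\<Sum>c | A \<subseteq> c \<and> c \<subseteq> V - {x}. g c + g (insert x c))"
proof -
  let ?C = "{c. A \<subseteq> c \<and> c \<subseteq> V - {x}}"
  have fin: "finite ?C" using assms by (auto intro: finite_subset[of _ "Pow V"])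
  have C: "{c. A \<subseteq> c \<and> c \<subseteq> V} = ?C \<union> insert x ` ?C"
  proof (intro equalityI subsetI)
    fix c assume "c \<in> {c. A \<subseteq> c \<and> c \<subseteq> V}"
    with assms show "c \<in> ?C \<union> insert x ` ?C"
      by (cases "x \<in> c") (auto intro!: image_eqI[where x = "c - {x}"])
  qed (use assms in auto)
  have "(\<Sum>c | A \<subseteq> c \<and> c \<subseteq> V. g c) = sum g ?C + sum g (insert x ` ?C)"
    unfolding C using fin by (intro sum.union_disjoint) auto
  also have "sum g (insert x ` ?C) = (\<Sum>c\<in>?C. g (insert x c))"
    by (rule sum.reindex_cong[where l = "insert x"]) (auto simp: inj_on_def)
  finally show ?thesis by (simp only: sum.distrib)
qed

text \<open>If \<open>A\<close> is not all of \<open>V\<close>, toggling an element outside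
  \<open>A\<close> flips the parity of the complement, so each pair cancels.\<close>

lemma sum_supersets_alternating:
  assumes "finite V" "A \<subseteq> V"
  shows "(\<Sum>c | A \<subseteq> c \<and> c \<subseteq> V. (-1) ^ card (V - c) :: real) = (if A = V then 1 else 0)"
proof (cases "A = V")
  case True
  then have "{c. A \<subseteq> c \<and> c \<subseteq> V} = {V}" by auto
  with True show ?thesis by simp
next
  case False
  then obtain x where x: "x \<in> V" "x \<notin> A" using assms by auto
  have "(-1) ^ card (V - c) + (-1) ^ card (V - insert x c) = (0::real)" if "c \<subseteq> V - {x}" for c
  proof -
    have "V - c = insert x (V - insert x c)" using that x by auto
    then have "card (V - c) = Suc (card (V - insert x c))"
      using assms by (metis Diff_iff card_insert_disjoint finite_Diff insertI1)
    then show ?thesis by simp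
  qed
  then show ?thesis
    using False x assms by (subst sum_supersets_pair[OF _ x]) (auto intro!: sum.neutral)
qed

text \<open>
  Pairing \<open>c\<close> with \<open>insert x c\<close> cancels the weight \<open>card c\<close> and leaves a plain alternating sum.
\<close>

lemma sum_supersets_alternating_card_nonneg:
  assumes "finite V" "A \<subseteq> V"
  shows "(\<Sum>c | A \<subseteq> c \<and> c \<subseteq> V. (-1) ^ card (V - c) * real (card c)) \<ge> 0"
proof (cases "A = V")
  case True
  then have "{c. A \<subseteq> c \<and> c \<subseteq> V} = {V}" by auto
  then show ?thesis by simp
next
  case False
  then obtain x where x: "x \<in> V" "x \<notin> A" using assms by auto
  let ?g = "\<lambda>c. (-1) ^ card (V - c) * real (card c)"
  have pair: "?g c + ?g (insert x c) = (-1) ^ card ((V - {x}) - c)" if "c \<subseteq> V - {x}" for c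
  proof -
    have "V - c = insert x (V - insert x c)" using that x by auto
    then have "card (V - c) = Suc (card (V - insert x c))"
      using assms by (metis Diff_iff card_insert_disjoint finite_Diff insertI1)
    moreover have "card (insert x c) = Suc (card c)"
      using that assms(1) by (intro card_insert_disjoint) (auto intro: finite_subset)
    moreover have "V - {x} - c = V - insert x c" by auto
    ultimately show ?thesis by (simp add: algebra_simps)
  qed
  have "(\<Sum>c | A \<subseteq> c \<and> c \<subseteq> V. ?g c) = (\<Sum>c | A \<subseteq> c \<and> c \<subseteq> V - {x}. (-1) ^ card ((V - {x}) - c))"
    by (subst sum_supersets_pair[OF assms(1) x], rule sum.cong[OF refl]) (use pair in blast)
  also have "\<dots> = (if A = V - {x} then 1 else 0)"
    using assms x by (intro sum_supersets_alternating) auto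
  finally show ?thesis by (simp split: if_splits)
qed

section \<open>Lebesgue measure on coordinate spaces\<close>

abbreviation leb :: "nat \<Rightarrow> (nat \<Rightarrow> real) measure" where
  "leb d \<equiv> Pi\<^sub>M {..<d} (\<lambda>_. lborel)"

abbreviation coords :: "nat \<Rightarrow> (nat \<Rightarrow> real) set" where
  "coords d \<equiv> PiE {..<d} (\<lambda>_. UNIV)"

abbreviation int_coords :: "nat \<Rightarrow> (nat \<Rightarrow> real) set" where
  "int_coords d \<equiv> PiE {..<d} (\<lambda>_. \<int>)"

abbreviation unit_cube :: "nat \<Rightarrow> (nat \<Rightarrow> real) set" where
  "unit_cube d \<equiv> PiE {..<d} (\<lambda>_. {0..<1})"

text \<open>The points of \<open>leb d\<close> are extensional functions, undefined from
  \<open>d\<close> on, and a plain pointwise sum would leave the space.\<close>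

definition padd :: "nat \<Rightarrow> (nat \<Rightarrow> real) \<Rightarrow> (nat \<Rightarrow> real) \<Rightarrow> nat \<Rightarrow> real" where
  "padd d x y = restrict (\<lambda>i. x i + y i) {..<d}"

lemma padd_apply [simp]: "i < d \<Longrightarrow> padd d x y i = x i + y i"
  by (simp add: padd_def)

lemma padd_in_coords [simp]: "padd d x y \<in> coords d"
  by (simp add: padd_def)

lemma space_leb: "space (leb d) = coords d"
  by (simp add: space_PiM)

lemma coords_eqI: "x \<in> coords d \<Longrightarrow> y \<in> coords d \<Longrightarrow> (\<And>i. i < d \<Longrightarrow> x i = y i) \<Longrightarrow> x = y"
  by (rule PiE_ext[where k = "{..<d}"]) auto

lemma measurable_padd [measurable]:
  assumes "f \<in> N \<rightarrow>\<^sub>M leb d" "g \<in> N \<rightarrow>\<^sub>M leb d"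
  shows "(\<lambda>x. padd d (f x) (g x)) \<in> N \<rightarrow>\<^sub>M leb d"
  unfolding padd_def
proof (intro measurable_restrict)
  fix i assume i: "i \<in> {..<d}"
  have "(\<lambda>x. f x i) \<in> N \<rightarrow>\<^sub>M borel" "(\<lambda>x. g x i) \<in> N \<rightarrow>\<^sub>M borel"
    using measurable_compose[OF assms(1) measurable_component_singleton[OF i]]
      measurable_compose[OF assms(2) measurable_component_singleton[OF i]] by auto
  then show "(\<lambda>x. f x i + g x i) \<in> N \<rightarrow>\<^sub>M lborel" by simp
qed

text \<open>Here \<open>c\<close> need not be extensional, so it need not be a point of
  \<open>leb d\<close>. The shifts \<open>\<tau> y\<close> used later are of this kind.\<close>

lemma measurable_padd_const [measurable]:
  assumes "f \<in> N \<rightarrow>\<^sub>M leb d"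
  shows "(\<lambda>x. padd d (f x) c) \<in> N \<rightarrow>\<^sub>M leb d"
proof -
  have "padd d x c = padd d x (restrict c {..<d})" for x
    by (rule coords_eqI[of _ d]) (auto simp: padd_def)
  moreover have "(\<lambda>x. padd d (f x) (restrict c {..<d})) \<in> N \<rightarrow>\<^sub>M leb d"
    by (intro measurable_padd assms measurable_const) (simp add: space_leb)
  ultimately show ?thesis by simp
qed

lemma distr_leb_padd: "distr (leb d) (leb d) (\<lambda>x. padd d x c) = leb d"
proof -
  interpret product_sigma_finite "\<lambda>_::nat. lborel :: real measure" by standard
  show ?thesis
  proof (rule PiM_eqI)
    fix A :: "nat \<Rightarrow> real set" assume A: "\<And>i. i \<in> {..<d} \<Longrightarrow> A i \<in> sets lborel"
    have shift: "(\<lambda>s. s + c i) -` A i \<in> sets borel \<and>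
      emeasure lborel ((\<lambda>s. s + c i) -` A i) = emeasure lborel (A i)" if "i < d" for i
    proof
      have m: "(\<lambda>s. s + c i) \<in> borel_measurable borel" by measurable
      show "(\<lambda>s. s + c i) -` A i \<in> sets borel"
        using measurable_sets[OF m, of "A i"] A that by simp
      have eq: "(\<lambda>s. s + c i) = (+) (c i)" by (auto simp: add.commute)
      have "emeasure lborel (A i) = emeasure (distr lborel borel (\<lambda>s. s + c i)) (A i)"
        unfolding eq lborel_distr_plus ..
      also have "\<dots> = emeasure lborel ((\<lambda>s. s + c i) -` A i)"
        using A that by (subst emeasure_distr) auto
      finally show "emeasure lborel ((\<lambda>s. s + c i) -` A i) = emeasure lborel (A i)" by simp
    qed
    have "(\<lambda>x. padd d x c) -` PiE {..<d} A \<inter> space (leb d) = PiE {..<d} (\<lambda>i. (\<lambda>s. s + c i) -` A i)"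
      by (auto simp: space_leb PiE_iff) (simp_all add: padd_def)
    moreover have "emeasure (leb d) (PiE {..<d} (\<lambda>i. (\<lambda>s. s + c i) -` A i)) =
        (\<Prod>i<d. emeasure lborel ((\<lambda>s. s + c i) -` A i))"
      using shift by (intro emeasure_PiM) auto
    ultimately show "emeasure (distr (leb d) (leb d) (\<lambda>x. padd d x c)) (PiE {..<d} A) =
        (\<Prod>i<d. emeasure lborel (A i))"
      using A shift by (subst emeasure_distr) (auto intro!: sets_PiM_I_finite measurable_padd_const)
  qed auto
qed

lemma nn_integral_leb_padd:
  assumes "f \<in> borel_measurable (leb d)"
  shows "(\<integral>\<^sup>+ x. f (padd d x c) \<partial>leb d) = (\<integral>\<^sup>+ x. f x \<partial>leb d)"
proof -
  have "(\<integral>\<^sup>+ x. f x \<partial>leb d) = (\<integral>\<^sup>+ x. f x \<partial>distr (leb d) (leb d) (\<lambda>x. padd d x c))"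
    by (simp add: distr_leb_padd)
  also have "\<dots> = (\<integral>\<^sup>+ x. f (padd d x c) \<partial>leb d)"
    using assms by (intro nn_integral_distr measurable_padd_const) (auto simp: measurable_distr_eq1)
  finally show ?thesis by simp
qed

lemma pair_sigma_finite_leb: "pair_sigma_finite (leb d) (leb d)"
proof -
  interpret product_sigma_finite "\<lambda>_::nat. lborel :: real measure" by standard
  have "sigma_finite_measure (leb d)" by (rule sigma_finite) simp
  then show ?thesis by (simp add: pair_sigma_finite_def)
qed

lemma unit_cube_sets [measurable]: "unit_cube d \<in> sets (leb d)"
  by (intro sets_PiM_I_finite) auto

lemma emeasure_unit_cube: "emeasure (leb d) (unit_cube d) = 1"
proof -
  interpret product_sigma_finite "\<lambda>_::nat. lborel :: real measure" by standard
  show ?thesis by (subst emeasure_PiM) auto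
qed

text \<open>
  The argument for the uniqueness of Haar measure: \<open>A \<mapsto> emeasure (leb d) (S -` A)\<close> is translation
  invariant, and Fubini's theorem, applied to its product with Lebesgue measure and the set
  \<open>A \<times> unit_cube d\<close>, compares the two measures. This replaces determinants, which are not available in
  the varying dimension \<open>d\<close>.
\<close>

lemma emeasure_equivariant_vimage:
  assumes S [measurable]: "S \<in> leb d \<rightarrow>\<^sub>M leb d"
    and equivariant: "\<And>t y. t \<in> coords d \<Longrightarrow> y \<in> coords d \<Longrightarrow> S (padd d t (\<tau> y)) = padd d (S t) y"
  shows "\<exists>\<kappa>. \<forall>A\<in>sets (leb d). emeasure (leb d) (S -` A \<inter> space (leb d)) = \<kappa> * emeasure (leb d) A"
\<comment> \<open>The constant is read off at the end: it is the measure of the set of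
  \<open>t\<close> whose negated image \<open>- S t\<close> lies in the unit cube, which does not
  involve \<open>A\<close>.\<close>
proof (intro exI ballI)
  interpret pair_sigma_finite "leb d" "leb d" by (rule pair_sigma_finite_leb)
  let ?M = "leb d" and ?Q = "unit_cube d"
  define neg where "neg x = restrict (\<lambda>i. - x i) {..<d}" for x :: "nat \<Rightarrow> real"
  have neg [measurable]: "neg \<in> ?M \<rightarrow>\<^sub>M ?M"
    unfolding neg_def by (intro measurable_restrict borel_measurable_uminus) simp_all
  have S_coords: "S t \<in> coords d" if "t \<in> coords d" for t
    using measurable_space[OF S, of t] that by (simp add: space_leb)
  fix A assume A [measurable]: "A \<in> sets ?M"
  have "emeasure ?M (S -` A \<inter> space ?M) = (\<integral>\<^sup>+ t. indicator A (S t) \<partial>?M)"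
    by (simp add: nn_integral_indicator[symmetric] measurable_sets[OF S A] del: nn_integral_indicator)
       (intro nn_integral_cong, auto simp: indicator_def)
  also have "\<dots> = (\<integral>\<^sup>+ t. \<integral>\<^sup>+ y. indicator A (S t) * indicator ?Q y \<partial>?M \<partial>?M)"
    by (simp add: nn_integral_cmult emeasure_unit_cube)
  also have "\<dots> = (\<integral>\<^sup>+ y. \<integral>\<^sup>+ t. indicator A (S t) * indicator ?Q y \<partial>?M \<partial>?M)"
    by (rule Fubini'[symmetric]) measurable
  \<comment> \<open>Shifting \<open>t\<close> by \<open>\<tau> y\<close> turns, by equivariance,
    into shifting \<open>S t\<close> by \<open>y\<close>.\<close>
  also have "\<dots> = (\<integral>\<^sup>+ y. \<integral>\<^sup>+ t. indicator A (S (padd d t (\<tau> y))) * indicator ?Q y \<partial>?M \<partial>?M)"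
    by (intro nn_integral_cong nn_integral_leb_padd[symmetric]) measurable
  also have "\<dots> = (\<integral>\<^sup>+ y. \<integral>\<^sup>+ t. indicator A (padd d (S t) y) * indicator ?Q y \<partial>?M \<partial>?M)"
    by (intro nn_integral_cong) (simp add: equivariant space_leb)
  also have "\<dots> = (\<integral>\<^sup>+ t. \<integral>\<^sup>+ y. indicator A (padd d (S t) y) * indicator ?Q y \<partial>?M \<partial>?M)"
    by (rule Fubini') measurable
  \<comment> \<open>Shifting \<open>y\<close> by \<open>- S t\<close> frees the indicator of
    \<open>A\<close> from \<open>S\<close> and moves the dependence on \<open>S t\<close> to the
    cube.\<close>
  also have "\<dots> = (\<integral>\<^sup>+ t. \<integral>\<^sup>+ y. indicator A (padd d (S t) (padd d y (neg (S t)))) *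
      indicator ?Q (padd d y (neg (S t))) \<partial>?M \<partial>?M)"
    by (intro nn_integral_cong nn_integral_leb_padd[symmetric]) measurable
  also have "\<dots> = (\<integral>\<^sup>+ t. \<integral>\<^sup>+ y. indicator A y * indicator ?Q (padd d y (neg (S t))) \<partial>?M \<partial>?M)"
  proof (intro nn_integral_cong)
    fix t y assume "t \<in> space ?M" "y \<in> space ?M"
    then have "padd d (S t) (padd d y (neg (S t))) = y"
      by (intro coords_eqI[of _ d]) (auto simp: space_leb neg_def)
    then show "indicator A (padd d (S t) (padd d y (neg (S t)))) * indicator ?Q (padd d y (neg (S t))) =
        (indicator A y * indicator ?Q (padd d y (neg (S t))) :: ennreal)" by simp
  qed
  also have "\<dots> = (\<integral>\<^sup>+ y. \<integral>\<^sup>+ t. indicator A y * indicator ?Q (padd d y (neg (S t))) \<partial>?M \<partial>?M)"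
    by (rule Fubini'[symmetric]) measurable
  \<comment> \<open>The same shift of \<open>t\<close> once more:
    \<open>y - S (t + \<tau> y)\<close> equals \<open>- S t\<close>, so \<open>y\<close> leaves the
    cube factor and the double integral becomes a product.\<close>
  also have "\<dots> = (\<integral>\<^sup>+ y. \<integral>\<^sup>+ t. indicator A y * indicator ?Q (padd d y (neg (S (padd d t (\<tau> y))))) \<partial>?M \<partial>?M)"
    by (intro nn_integral_cong nn_integral_leb_padd[symmetric]) measurable
  also have "\<dots> = (\<integral>\<^sup>+ y. \<integral>\<^sup>+ t. indicator A y * indicator ?Q (neg (S t)) \<partial>?M \<partial>?M)"
  proof (intro nn_integral_cong)
    fix t y assume "t \<in> space ?M" "y \<in> space ?M"
    then have "padd d y (neg (S (padd d t (\<tau> y)))) = neg (S t)"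
      by (intro coords_eqI[of _ d]) (auto simp: space_leb neg_def equivariant)
    then show "indicator A y * indicator ?Q (padd d y (neg (S (padd d t (\<tau> y))))) =
        (indicator A y * indicator ?Q (neg (S t)) :: ennreal)" by simp
  qed
  also have "\<dots> = (\<integral>\<^sup>+ y. (\<integral>\<^sup>+ t. indicator ?Q (neg (S t)) \<partial>?M) * indicator A y \<partial>?M)"
    by (intro nn_integral_cong) (simp add: nn_integral_cmult mult.commute)
  also have "\<dots> = (\<integral>\<^sup>+ t. indicator ?Q (neg (S t)) \<partial>?M) * emeasure ?M A"
    by (simp add: nn_integral_cmult)
  finally show "emeasure ?M (S -` A \<inter> space ?M) = (\<integral>\<^sup>+ t. indicator ?Q (neg (S t)) \<partial>?M) * emeasure ?M A" .
qed

section \<open>Integral translates and counting modulo the integer lattice\<close>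

lemma countable_int_coords: "countable (int_coords d)"
  by (intro countable_PiE) (auto simp: Ints_def)

text \<open>Unfolding: cut \<open>A\<close> along the integral translates of the unit cube and move the pieces back.\<close>

lemma emeasure_eq_card_int_translates:
  assumes A [measurable]: "A \<in> sets (leb d)"
    and card: "\<And>t. t \<in> coords d \<Longrightarrow> finite {a \<in> int_coords d. padd d t a \<in> A} \<and>
      card {a \<in> int_coords d. padd d t a \<in> A} = N"
  shows "emeasure (leb d) A = of_nat N"
proof -
  let ?M = "leb d" and ?Q = "unit_cube d" and ?Z = "int_coords d"
  define neg where "neg x = restrict (\<lambda>i. - x i) {..<d}" for x :: "nat \<Rightarrow> real"
  \<comment> \<open>The half-open cube is a fundamental domain: the only integral vector that can be
    subtracted from \<open>t\<close> to land in it consists of the floors.\<close>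
  have one: "(\<integral>\<^sup>+ a. indicator ?Q (padd d t (neg a)) \<partial>count_space ?Z) = (1::ennreal)"
    if t: "t \<in> coords d" for t
  proof -
    let ?a = "restrict (\<lambda>i. of_int \<lfloor>t i\<rfloor> :: real) {..<d}"
    have "{a \<in> ?Z. padd d t (neg a) \<in> ?Q} = {?a}"
    proof (intro equalityI subsetI)
      fix a assume a: "a \<in> {a \<in> ?Z. padd d t (neg a) \<in> ?Q}"
      have "a i = of_int \<lfloor>t i\<rfloor>" if i: "i < d" for i
      proof -
        have "a i \<in> \<int>" "padd d t (neg a) i \<in> {0..<1}"
          using a i by (auto simp: PiE_iff simp del: padd_apply)
        then have "a i \<in> \<int>" "a i \<le> t i" "t i < a i + 1" using i by (auto simp: neg_def)
        then show ?thesis by (metis Ints_cases floor_unique of_int_floor_cancel)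
      qed
      moreover have "a \<in> coords d" using a by (auto simp: PiE_iff)
      ultimately show "a \<in> {?a}" by (auto intro!: coords_eqI[of _ d])
    next
      fix a assume "a \<in> {?a}"
      then show "a \<in> {a \<in> ?Z. padd d t (neg a) \<in> ?Q}"
        by (auto simp: PiE_iff neg_def padd_def) linarith+
    qed
    then have "emeasure (count_space ?Z) {a \<in> ?Z. padd d t (neg a) \<in> ?Q} = 1"
      by simp
    moreover have "(\<integral>\<^sup>+ a. indicator ?Q (padd d t (neg a)) \<partial>count_space ?Z) =
        (\<integral>\<^sup>+ a. indicator {a \<in> ?Z. padd d t (neg a) \<in> ?Q} a \<partial>count_space ?Z)"
      by (intro nn_integral_cong) (auto simp: indicator_def)
    ultimately show ?thesis by (simp add: nn_integral_indicator)
  qed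
  have N: "(\<integral>\<^sup>+ a. indicator A (padd d t a) \<partial>count_space ?Z) = (of_nat N :: ennreal)"
    if t: "t \<in> coords d" for t
  proof -
    have "(\<integral>\<^sup>+ a. indicator A (padd d t a) \<partial>count_space ?Z) =
        (\<integral>\<^sup>+ a. indicator {a \<in> ?Z. padd d t a \<in> A} a \<partial>count_space ?Z)"
      by (intro nn_integral_cong) (auto simp: indicator_def)
    also have "\<dots> = emeasure (count_space ?Z) {a \<in> ?Z. padd d t a \<in> A}"
      by (simp add: nn_integral_indicator)
    also have "\<dots> = of_nat N" using card[OF t] by (subst emeasure_count_space) auto
    finally show ?thesis .
  qed
  have "emeasure ?M A = (\<integral>\<^sup>+ t. indicator A t * (\<integral>\<^sup>+ a. indicator ?Q (padd d t (neg a)) \<partial>count_space ?Z) \<partial>?M)"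
    by (simp add: nn_integral_indicator[symmetric] del: nn_integral_indicator)
       (intro nn_integral_cong, simp add: one space_leb)
  also have "\<dots> = (\<integral>\<^sup>+ t. \<integral>\<^sup>+ a. indicator A t * indicator ?Q (padd d t (neg a)) \<partial>count_space ?Z \<partial>?M)"
    by (intro nn_integral_cong) (simp add: nn_integral_cmult)
  also have "\<dots> = (\<integral>\<^sup>+ a. \<integral>\<^sup>+ t. indicator A t * indicator ?Q (padd d t (neg a)) \<partial>?M \<partial>count_space ?Z)"
    by (intro nn_integral_count_space_nn_integral countable_int_coords) measurable
  also have "\<dots> = (\<integral>\<^sup>+ a. \<integral>\<^sup>+ t. indicator A (padd d t a) * indicator ?Q (padd d (padd d t a) (neg a)) \<partial>?M \<partial>count_space ?Z)"
    by (intro nn_integral_cong nn_integral_leb_padd[symmetric]) measurable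
  also have "\<dots> = (\<integral>\<^sup>+ a. \<integral>\<^sup>+ t. indicator A (padd d t a) * indicator ?Q t \<partial>?M \<partial>count_space ?Z)"
  proof (intro nn_integral_cong)
    fix a t assume "t \<in> space ?M"
    then have "padd d (padd d t a) (neg a) = t"
      by (intro coords_eqI[of _ d]) (auto simp: space_leb neg_def)
    then show "indicator A (padd d t a) * indicator ?Q (padd d (padd d t a) (neg a)) =
        (indicator A (padd d t a) * indicator ?Q t :: ennreal)" by simp
  qed
  also have "\<dots> = (\<integral>\<^sup>+ t. \<integral>\<^sup>+ a. indicator A (padd d t a) * indicator ?Q t \<partial>count_space ?Z \<partial>?M)"
    by (intro nn_integral_count_space_nn_integral[symmetric] countable_int_coords) measurable
  also have "\<dots> = (\<integral>\<^sup>+ t. of_nat N * indicator ?Q t \<partial>?M)"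
    by (intro nn_integral_cong) (simp add: nn_integral_multc N space_leb)
  also have "\<dots> = of_nat N"
    by (simp add: nn_integral_cmult emeasure_unit_cube)
  finally show ?thesis .
qed

text \<open>\<open>H\<close> is a union of cosets of the integral vectors, and each coset meets
  every translate of the half-open cube exactly once. The number of points of \<open>H\<close> in a
  translate is therefore independent of \<open>s\<close>.\<close>

lemma bij_betw_frac_translate:
  assumes H: "H \<subseteq> coords d" "\<And>h a. h \<in> H \<Longrightarrow> a \<in> int_coords d \<Longrightarrow> padd d h a \<in> H"
  shows "bij_betw (\<lambda>h. restrict (\<lambda>i. frac (h i)) {..<d}) {h \<in> H. padd d s h \<in> unit_cube d} (H \<inter> unit_cube d)"
proof (rule bij_betwI')
  fix h k assume h: "h \<in> {h \<in> H. padd d s h \<in> unit_cube d}" and k: "k \<in> {h \<in> H. padd d s h \<in> unit_cube d}"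
  show "restrict (\<lambda>i. frac (h i)) {..<d} = restrict (\<lambda>i. frac (k i)) {..<d} \<longleftrightarrow> h = k"
  proof
    assume eq: "restrict (\<lambda>i. frac (h i)) {..<d} = restrict (\<lambda>i. frac (k i)) {..<d}"
    have "h i = k i" if i: "i < d" for i
    proof -
      have "frac (h i) = frac (k i)" using fun_cong[OF eq, of i] i by simp
      then have "h i - of_int \<lfloor>h i\<rfloor> = k i - of_int \<lfloor>k i\<rfloor>" by (simp add: frac_def)
      moreover have "padd d s h i \<in> {0..<1}" "padd d s k i \<in> {0..<1}"
        using h k i by (auto simp: PiE_iff simp del: padd_apply)
      then have "0 \<le> s i + h i" "s i + h i < 1" "0 \<le> s i + k i" "s i + k i < 1"
        using i by auto
      ultimately have "\<lfloor>h i\<rfloor> = \<lfloor>k i\<rfloor>"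
        by linarith
      with \<open>h i - of_int \<lfloor>h i\<rfloor> = k i - of_int \<lfloor>k i\<rfloor>\<close> show ?thesis by simp
    qed
    then show "h = k" using h k H(1) by (intro coords_eqI[of _ d]) auto
  qed simp
next
  fix h assume h: "h \<in> {h \<in> H. padd d s h \<in> unit_cube d}"
  have "restrict (\<lambda>i. frac (h i)) {..<d} = padd d h (restrict (\<lambda>i. of_int (- \<lfloor>h i\<rfloor>)) {..<d})"
    by (rule coords_eqI[of _ d]) (auto simp: frac_def)
  moreover have "padd d h (restrict (\<lambda>i. of_int (- \<lfloor>h i\<rfloor>)) {..<d}) \<in> H"
    using h by (intro H(2)) auto
  ultimately have "restrict (\<lambda>i. frac (h i)) {..<d} \<in> H"
    by (simp only:)
  then show "restrict (\<lambda>i. frac (h i)) {..<d} \<in> H \<inter> unit_cube d"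
    by (auto simp: frac_ge_0 frac_lt_1)
next
  fix g assume g: "g \<in> H \<inter> unit_cube d"
  \<comment> \<open>Subtracting the floors of \<open>s i + g i\<close> moves \<open>s + g\<close>
    into the cube, and an integral shift preserves fractional parts.\<close>
  let ?h = "padd d g (restrict (\<lambda>i. of_int (- \<lfloor>s i + g i\<rfloor>)) {..<d})"
  have gi: "0 \<le> g i" "g i < 1" if "i < d" for i using g that by (auto simp: PiE_iff)
  have "?h \<in> H" using g by (intro H(2)) auto
  moreover have "padd d s ?h \<in> unit_cube d"
    by (auto simp: padd_def) linarith+
  moreover have "g = restrict (\<lambda>i. frac (?h i)) {..<d}"
  proof (rule coords_eqI[of _ d])
    fix i assume i: "i < d"
    have "frac (g i - of_int \<lfloor>s i + g i\<rfloor>) = g i"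
      using gi[OF i] by (subst frac_unique_iff) auto
    then show "g i = restrict (\<lambda>i. frac (?h i)) {..<d} i" using i by simp
  qed (use g in auto)
  ultimately show "\<exists>h\<in>{h \<in> H. padd d s h \<in> unit_cube d}. g = restrict (\<lambda>i. frac (h i)) {..<d}"
    by blast
qed

section \<open>Volume of a simplex in lattice coordinates\<close>

lemma lincomb_padd: "lincomb d b (padd d x y) = lincomb d b x + lincomb d b y"
  unfolding lincomb_add[symmetric] by (rule lincomb_cong) auto

lemma lincomb_restrict: "lincomb d b (restrict t {..<d}) = lincomb d b t"
  by (rule lincomb_cong) auto

lemma finite_cube_lattice_points:
  fixes w :: "nat \<Rightarrow> real ^ 'n"
  assumes "lin_indep d w"
  shows "finite {x \<in> unit_cube d. lincomb d w x \<in> integer_points}" (is "finite ?X")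
proof -
  have "lincomb d w ` ?X \<subseteq> {x \<in> integer_points. \<exists>t. x = lincomb d w t \<and> (\<forall>i<d. 0 \<le> t i \<and> t i \<le> 1)}"
    by (force simp: PiE_iff)
  then have "finite (lincomb d w ` ?X)"
    using finite_parallelepiped_integer_points finite_subset by blast
  moreover have "inj_on (lincomb d w) ?X"
  proof (rule inj_onI)
    fix x y assume xy: "x \<in> ?X" "y \<in> ?X" "lincomb d w x = lincomb d w y"
    have "unit_cube d \<subseteq> coords d" by (intro PiE_mono) simp
    with xy show "x = y" by (intro coords_eqI[of _ d]) (auto intro: lin_indepD[OF assms])
  qed
  ultimately show ?thesis by (rule finite_imageD)
qed

text \<open>The scaling constant of the coordinate change is found on the half-open unit cube and
  then used on the standard simplex, whose measure \<open>1 / fact d\<close> absorbs the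
  normalisation. The offset \<open>e\<close> allows the base point of the lattice basis to differ
  from the vertex at which the edges \<open>w\<close> start.\<close>

lemma measure_simplex_coords:
  fixes b w :: "nat \<Rightarrow> real ^ 'n"
  assumes w: "lin_indep d w" "\<And>i. i < d \<Longrightarrow> w i \<in> integer_points"
    and b: "lin_indep d b" "\<And>i. i < d \<Longrightarrow> b i \<in> integer_points"
    and range_eq: "range (lincomb d b) = range (lincomb d w)"
    and lattice: "\<And>x. x \<in> range (lincomb d w) \<Longrightarrow> x \<in> integer_points \<Longrightarrow>
      \<exists>a::nat \<Rightarrow> int. x = lincomb d b (\<lambda>i. of_int (a i))"
    and e: "e \<in> range (lincomb d w)"
  shows "fact d * measure (leb d) {t \<in> coords d. \<exists>x. e + lincomb d b t = lincomb d w x \<and>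
      (\<forall>i<d. 0 \<le> x i) \<and> (\<Sum>i<d. x i) \<le> 1} =
    card {x \<in> unit_cube d. lincomb d w x \<in> integer_points}"
proof -
  let ?M = "leb d" and ?Q = "unit_cube d"
  define H where "H = {x \<in> coords d. lincomb d w x \<in> integer_points}"
  obtain \<epsilon> where \<epsilon>: "e = lincomb d w \<epsilon>" using e by auto
  have "\<exists>t. b i = lincomb d w t" if "i < d" for i
    using range_eq lincomb_unit[OF that, of b] by (metis rangeE rangeI)
  then obtain c where c: "\<And>i. i < d \<Longrightarrow> b i = lincomb d w (c i)" by metis
  have "\<exists>t. w i = lincomb d b t" if "i < d" for i
    using range_eq lincomb_unit[OF that, of w] by (metis rangeE rangeI)
  then obtain m where m: "\<And>i. i < d \<Longrightarrow> w i = lincomb d b (m i)" by metis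
  \<comment> \<open>\<open>S t\<close> are the \<open>w\<close>-coordinates of \<open>e + lincomb d b t\<close>, \<open>S0\<close> is the linear part of \<open>S\<close>,
    and \<open>\<tau>\<close> the inverse of \<open>S0\<close>.\<close>
  define S0 where "S0 t = restrict (\<lambda>j. \<Sum>i<d. t i * c i j) {..<d}" for t
  define S where "S t = restrict (\<lambda>j. \<epsilon> j + (\<Sum>i<d. t i * c i j)) {..<d}" for t
  define \<tau> where "\<tau> y i = (\<Sum>j<d. y j * m j i)" for y i
  have S0: "lincomb d w (S0 t) = lincomb d b t" for t
    unfolding S0_def lincomb_restrict lincomb_lincomb[symmetric] using c by (intro lincomb_cong) auto
  have S: "lincomb d w (S t) = e + lincomb d b t" for t
    unfolding S_def lincomb_restrict lincomb_add \<epsilon>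
    using S0 unfolding S0_def lincomb_restrict by simp
  have \<tau>: "lincomb d b (\<tau> y) = lincomb d w y" for y
    unfolding \<tau>_def lincomb_lincomb[symmetric] using m by (intro lincomb_cong) auto
  have S_coords [simp]: "S t \<in> coords d" "S0 t \<in> coords d" for t
    by (auto simp: S_def S0_def)
  have w_eqI: "x = y" if "x \<in> coords d" "y \<in> coords d" "lincomb d w x = lincomb d w y" for x y
    using that by (intro coords_eqI[of _ d]) (auto intro: lin_indepD[OF w(1)])
  have S_meas [measurable]: "S \<in> ?M \<rightarrow>\<^sub>M ?M"
    unfolding S_def by measurable
  \<comment> \<open>A shift by \<open>y\<close> in \<open>w\<close>-coordinates is a shift by
    \<open>\<tau> y\<close> in \<open>b\<close>-coordinates, which is the equivariance that yields
    \<open>\<kappa>\<close>.\<close>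
  have equiv: "S (padd d t (\<tau> y)) = padd d (S t) y" for t y
    by (rule w_eqI) (auto simp: S lincomb_padd \<tau>)
  have equiv0: "S (padd d t a) = padd d (S t) (S0 a)" for t a
    by (rule w_eqI) (auto simp: S S0 lincomb_padd)
  obtain \<kappa> where \<kappa>: "\<And>A. A \<in> sets ?M \<Longrightarrow> emeasure ?M (S -` A \<inter> space ?M) = \<kappa> * emeasure ?M A"
    using emeasure_equivariant_vimage[OF S_meas, of \<tau>] equiv by blast
  have "?Q \<subseteq> coords d" by (intro PiE_mono) simp
  then have HQ: "H \<inter> ?Q = {x \<in> ?Q. lincomb d w x \<in> integer_points}"
    unfolding H_def by blast
  then have fin: "finite (H \<inter> ?Q)" using finite_cube_lattice_points[OF w(1)] by simp
  \<comment> \<open>The edge vectors are integer points, so the lattice \<open>H\<close> in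
    \<open>w\<close>-coordinates contains all integral vectors.\<close>
  have H_closed: "padd d h a \<in> H" if "h \<in> H" "a \<in> int_coords d" for h a
    using that w(2) by (auto simp: H_def lincomb_padd intro!: integer_points_add integer_points_lincomb)
  \<comment> \<open>As \<open>b\<close> is a lattice basis, \<open>S0\<close> maps the integral
    vectors one-to-one onto \<open>H\<close>. By \<open>equiv0\<close>, the integral translates of
    \<open>t\<close> that \<open>S\<close> sends into the cube become the points of \<open>H\<close>
    in a translate of the cube, and their number does not depend on \<open>t\<close>.\<close>
  have bij: "bij_betw S0 {a \<in> int_coords d. padd d t a \<in> S -` ?Q \<inter> space ?M} {h \<in> H. padd d (S t) h \<in> ?Q}" for t
  proof (rule bij_betwI')
    fix x y assume x: "x \<in> {a \<in> int_coords d. padd d t a \<in> S -` ?Q \<inter> space ?M}"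
      and y: "y \<in> {a \<in> int_coords d. padd d t a \<in> S -` ?Q \<inter> space ?M}"
    show "S0 x = S0 y \<longleftrightarrow> x = y"
    proof
      assume "S0 x = S0 y"
      then have "lincomb d b x = lincomb d b y" by (metis S0)
      then have "x i = y i" if "i < d" for i using lin_indepD[OF b(1)] that by blast
      moreover have "x \<in> coords d" "y \<in> coords d" using x y by (auto simp: PiE_iff)
      ultimately show "x = y" by (intro coords_eqI[of _ d])
    qed simp
  next
    fix x assume x: "x \<in> {a \<in> int_coords d. padd d t a \<in> S -` ?Q \<inter> space ?M}"
    then have "lincomb d b x \<in> integer_points" using b(2) by (intro integer_points_lincomb) auto
    then show "S0 x \<in> {h \<in> H. padd d (S t) h \<in> ?Q}"
      using x by (simp add: H_def S0 equiv0)
  next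
    fix h assume h: "h \<in> {h \<in> H. padd d (S t) h \<in> ?Q}"
    then obtain a :: "nat \<Rightarrow> int" where a: "lincomb d w h = lincomb d b (\<lambda>i. of_int (a i))"
      using lattice[of "lincomb d w h"] by (auto simp: H_def)
    let ?a = "restrict (\<lambda>i. of_int (a i) :: real) {..<d}"
    have "S0 ?a = h" using h a by (intro w_eqI) (auto simp: H_def S0 lincomb_restrict)
    with h show "\<exists>x\<in>{a \<in> int_coords d. padd d t a \<in> S -` ?Q \<inter> space ?M}. h = S0 x"
      by (intro bexI[of _ ?a]) (auto simp: equiv0 space_leb simp del: PiE_iff)
  qed
  have "emeasure ?M (S -` ?Q \<inter> space ?M) = of_nat (card (H \<inter> ?Q))"
  proof (rule emeasure_eq_card_int_translates)
    show "S -` ?Q \<inter> space ?M \<in> sets ?M" by measurable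
    fix t
    have "H \<subseteq> coords d" by (auto simp: H_def)
    from bij_betw_trans[OF bij bij_betw_frac_translate[OF this H_closed, of "S t"]] fin
    show "finite {a \<in> int_coords d. padd d t a \<in> S -` ?Q \<inter> space ?M} \<and>
      card {a \<in> int_coords d. padd d t a \<in> S -` ?Q \<inter> space ?M} = card (H \<inter> ?Q)"
      by (metis (no_types, lifting) bij_betw_finite bij_betw_same_card)
  qed
  \<comment> \<open>The cube has measure 1, so the measure of its preimage is
    \<open>\<kappa>\<close> itself.\<close>
  then have \<kappa>_eq: "\<kappa> = of_nat (card (H \<inter> ?Q))"
    using \<kappa>[of ?Q] by (simp add: emeasure_unit_cube unit_cube_sets)
  let ?D = "{x. (\<forall>i\<in>{..<d}. 0 \<le> x i) \<and> sum x {..<d} \<le> 1} \<inter> space ?M"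
  have D: "?D \<in> sets ?M"
  proof -
    have "?D = {x \<in> space ?M. (\<forall>i\<in>{..<d}. 0 \<le> x i) \<and> (\<Sum>i<d. x i) \<le> 1}" by auto
    also have "\<dots> \<in> sets ?M" by measurable
    finally show ?thesis .
  qed
  have "S -` ?D \<inter> space ?M = {t \<in> coords d. \<exists>x. e + lincomb d b t = lincomb d w x \<and>
      (\<forall>i<d. 0 \<le> x i) \<and> (\<Sum>i<d. x i) \<le> 1}" (is "_ = ?T")
  proof (intro equalityI subsetI)
    fix t assume "t \<in> S -` ?D \<inter> space ?M"
    then show "t \<in> ?T"
      using S[of t] by (auto simp: space_leb intro!: exI[of _ "S t"])
  next
    fix t assume "t \<in> ?T"
    then obtain x where t: "t \<in> coords d" and x: "e + lincomb d b t = lincomb d w x"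
      "\<forall>i<d. 0 \<le> x i" "(\<Sum>i<d. x i) \<le> 1" by auto
    have "S t i = x i" if "i < d" for i
      using lin_indepD[OF w(1), of "S t" x i] S[of t] x(1) that by simp
    then show "t \<in> S -` ?D \<inter> space ?M" using x t by (simp add: space_leb)
  qed
  then have "emeasure ?M ?T = \<kappa> * emeasure ?M ?D"
    using \<kappa>[OF D] by simp
  also have "emeasure ?M ?D = ennreal (1 / fact d)"
    using emeasure_std_simplex_aux[of "{..<d}" 1] by (simp add: ennreal_1[symmetric] divide_ennreal del: ennreal_1)
  finally have "emeasure ?M ?T = ennreal (real (card (H \<inter> ?Q)) / fact d)"
    by (simp add: \<kappa>_eq ennreal_of_nat_eq_real_of_nat ennreal_mult[symmetric])
  then have "measure ?M ?T = real (card (H \<inter> ?Q)) / fact d"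
    by (simp add: measure_def)
  then show ?thesis by (simp add: HQ)
qed

section \<open>Normalised volumes of lattice simplices\<close>

lemma affine_param_eq: "affine_param d p b t = p + lincomb d b t"
  by (simp add: affine_param_def lincomb_def)

lemma affine_lattice_basis_iff:
  "affine_lattice_basis L d p b \<longleftrightarrow>
     lin_indep d b \<and> L = {p + lincomb d b (\<lambda>i. of_int (a i)) | a :: nat \<Rightarrow> int. True}"
  by (simp add: affine_lattice_basis_def lin_indep_iff_independent affine_param_eq)

text \<open>
  For affinely independent \<open>c\<close> these functions represent the finite abelian group
  \<open>L / \<Sum>v\<in>c. \<int> (v, 1)\<close>, where \<open>L\<close> consists of the integer points of the linear span of
  \<open>c \<times> {1}\<close>. Extending them by 0 outside \<open>c\<close> makes the groups of the faces literal subsets of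
  the group of the simplex.
\<close>

definition box_points :: "(real ^ 'n) set \<Rightarrow> (real ^ 'n \<Rightarrow> real) set" where
  "box_points c = {u. (\<forall>v. 0 \<le> u v \<and> u v < 1) \<and> (\<forall>v. v \<notin> c \<longrightarrow> u v = 0) \<and>
     sum u c \<in> \<int> \<and> (\<Sum>v\<in>c. u v *\<^sub>R v) \<in> integer_points}"

lemma box_points_subset:
  assumes "finite V" "c \<subseteq> V"
  shows "box_points c = {u \<in> box_points V. {v. u v \<noteq> 0} \<subseteq> c}"
proof (rule set_eqI)
  fix u
  show "u \<in> box_points c \<longleftrightarrow> u \<in> {u \<in> box_points V. {v. u v \<noteq> 0} \<subseteq> c}"
  proof (cases "{v. u v \<noteq> 0} \<subseteq> c")
    case True
    have "sum u c = sum u V" "(\<Sum>v\<in>c. u v *\<^sub>R v) = (\<Sum>v\<in>V. u v *\<^sub>R v)"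
      using assms True by (auto intro!: sum.mono_neutral_left)
    then show ?thesis using True assms by (auto simp: box_points_def)
  next
    case False
    then show ?thesis by (auto simp: box_points_def)
  qed
qed

text \<open>One vertex serves as origin and \<open>h\<close> enumerates the others, so that the
  edges at \<open>v0\<close> form a family to which the coordinate results apply.\<close>

locale lattice_simplex_chart =
  fixes c :: "(real ^ 'n) set" and v0 :: "real ^ 'n" and d :: nat and h :: "nat \<Rightarrow> real ^ 'n"
  assumes finite_c: "finite c" and integral: "c \<subseteq> integer_points"
    and affine_indep: "\<not> affine_dependent c" and v0: "v0 \<in> c"
    and bij_h: "bij_betw h {..<d} (c - {v0})"
begin

definition w :: "nat \<Rightarrow> real ^ 'n" where "w i = h i - v0"

lemma inj_h: "inj_on h {..<d}" and h_image: "h ` {..<d} = c - {v0}"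
  using bij_h by (auto simp: bij_betw_def)

lemma w_image: "w ` {..<d} = (\<lambda>x. - v0 + x) ` (c - {v0})"
  by (simp add: w_def h_image[symmetric] image_image)

lemma card_c: "card c = d + 1"
  using bij_betw_same_card[OF bij_h] finite_c v0 by (simp add: card_Diff_singleton)
    (metis One_nat_def Suc_pred card_gt_0_iff empty_iff)

lemma w_integral: "i < d \<Longrightarrow> w i \<in> integer_points"
  using h_image integral v0 by (auto simp: w_def intro!: integer_points_diff)

lemma lin_indep_w: "lin_indep d w"
proof -
  have "inj_on w {..<d}" using inj_h by (simp add: inj_on_def w_def)
  moreover have "independent (w ` {..<d})"
    using affine_indep affine_dependent_iff_dependent2[OF v0] by (simp add: w_image)
  ultimately show ?thesis by (simp add: lin_indep_iff_independent)
qed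

lemma affine_hull_c: "affine hull c = (+) v0 ` range (lincomb d w)"
  unfolding affine_hull_span2[OF v0] w_image[symmetric] span_image_lessThan ..

lemma sum_c:
  fixes f :: "_ \<Rightarrow> 'b::comm_monoid_add"
  shows "sum f c = f v0 + (\<Sum>i<d. f (h i))"
proof -
  have "sum f c = f v0 + sum f (c - {v0})" using finite_c v0 by (rule sum.remove)
  also have "sum f (c - {v0}) = (\<Sum>i<d. f (h i))"
    unfolding h_image[symmetric] by (simp add: sum.reindex[OF inj_h])
  finally show ?thesis .
qed

lemma sum_scaled_c: "(\<Sum>v\<in>c. u v *\<^sub>R v) = sum u c *\<^sub>R v0 + lincomb d w (\<lambda>i. u (h i))"
  unfolding sum_c
  by (simp add: lincomb_def w_def scaleR_diff_right sum_subtractf scaleR_add_left scaleR_sum_left)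

text \<open>Barycentric coordinates with the weight of \<open>v0\<close> eliminated: it is 1 minus
  the sum of the others, and its nonnegativity becomes the bound on the sum.\<close>

lemma convex_hull_c:
  "v0 + y \<in> convex hull c \<longleftrightarrow> (\<exists>x. y = lincomb d w x \<and> (\<forall>i<d. 0 \<le> x i) \<and> (\<Sum>i<d. x i) \<le> 1)"
proof
  assume "v0 + y \<in> convex hull c"
  then obtain u where u: "\<forall>v\<in>c. 0 \<le> u v" "sum u c = 1" "(\<Sum>v\<in>c. u v *\<^sub>R v) = v0 + y"
    by (auto simp: convex_hull_finite[OF finite_c])
  have "y = lincomb d w (\<lambda>i. u (h i))" using u(2,3) unfolding sum_scaled_c by simp
  moreover have "\<forall>i<d. 0 \<le> u (h i)" using u(1) h_image by auto
  moreover have "(\<Sum>i<d. u (h i)) \<le> 1" using u(2) bspec[OF u(1) v0] by (simp add: sum_c)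
  ultimately show "\<exists>x. y = lincomb d w x \<and> (\<forall>i<d. 0 \<le> x i) \<and> (\<Sum>i<d. x i) \<le> 1" by blast
next
  assume "\<exists>x. y = lincomb d w x \<and> (\<forall>i<d. 0 \<le> x i) \<and> (\<Sum>i<d. x i) \<le> 1"
  then obtain x where x: "y = lincomb d w x" "\<And>i. i < d \<Longrightarrow> 0 \<le> x i" "(\<Sum>i<d. x i) \<le> 1" by auto
  define u where "u v = (if v = v0 then 1 - (\<Sum>i<d. x i) else x (the_inv_into {..<d} h v))" for v
  have u: "u (h i) = x i" if "i < d" for i
    using that h_image by (auto simp: u_def the_inv_into_f_f[OF inj_h])
  then have "sum u c = 1" by (simp add: sum_c u_def[of v0])
  moreover have "(\<Sum>v\<in>c. u v *\<^sub>R v) = v0 + y"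
    using \<open>sum u c = 1\<close> x(1) u unfolding sum_scaled_c by (simp cong: lincomb_cong)
  moreover have "0 \<le> u v" if "v \<in> c" for v
  proof (cases "v = v0")
    case True
    then show ?thesis using x(3) by (simp add: u_def)
  next
    case False
    then have "v \<in> h ` {..<d}" using that by (simp add: h_image)
    then obtain i where "i < d" "v = h i" by auto
    then show ?thesis using u x(2) by simp
  qed
  ultimately show "v0 + y \<in> convex hull c"
    unfolding convex_hull_finite[OF finite_c] by blast
qed

lemma affine_lattice_basis_exists: "\<exists>p b. affine_lattice_basis (affine hull c \<inter> integer_points) d p b"
proof -
  obtain b where b: "lin_indep d b" "\<And>i. i < d \<Longrightarrow> b i \<in> integer_points"
    "range (lincomb d b) = range (lincomb d w)"
    "\<And>x. x \<in> range (lincomb d w) \<Longrightarrow> x \<in> integer_points \<Longrightarrow>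
       \<exists>a::nat \<Rightarrow> int. x = lincomb d b (\<lambda>i. of_int (a i))"
    using lattice_basis_exists[OF lin_indep_w w_integral] by blast
  have v0_int: "v0 \<in> integer_points" using v0 integral by blast
  have "affine hull c \<inter> integer_points = {v0 + lincomb d b (\<lambda>i. of_int (a i)) | a :: nat \<Rightarrow> int. True}"
    (is "_ = ?R")
  proof (intro equalityI subsetI)
    fix x assume x: "x \<in> affine hull c \<inter> integer_points"
    then have "x - v0 \<in> range (lincomb d w)" "x - v0 \<in> integer_points"
      using v0_int by (auto simp: affine_hull_c integer_points_diff)
    from b(4)[OF this] obtain a :: "nat \<Rightarrow> int" where "x - v0 = lincomb d b (\<lambda>i. of_int (a i))" ..
    then have "x = v0 + lincomb d b (\<lambda>i. of_int (a i))" by (simp add: algebra_simps)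
    then show "x \<in> ?R" by blast
  next
    fix x assume "x \<in> ?R"
    then obtain a :: "nat \<Rightarrow> int" where x: "x = v0 + lincomb d b (\<lambda>i. of_int (a i))" by blast
    have "x \<in> integer_points"
      unfolding x using v0_int b(2) by (intro integer_points_add integer_points_lincomb) auto
    moreover have "x \<in> affine hull c"
      unfolding x affine_hull_c b(3)[symmetric] by blast
    ultimately show "x \<in> affine hull c \<inter> integer_points" by simp
  qed
  with b(1) show ?thesis unfolding affine_lattice_basis_iff by blast
qed

text \<open>Only the basis property of the chosen \<open>p\<close> and \<open>b\<close> is known.
  Zero and unit coefficients put \<open>p\<close> and \<open>p + b i\<close> into the lattice, which
  makes each \<open>b i\<close> integral and parallel to the hull. Conversely, the vertices are
  lattice points, which puts every edge into the span of \<open>b\<close>.\<close>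

lemma lattice_volume_eq_card_cube:
  "lattice_volume (convex hull c) = card {x \<in> unit_cube d. lincomb d w x \<in> integer_points}"
proof -
  let ?L = "affine hull c \<inter> integer_points"
  define pb where "pb = (SOME (p, b). affine_lattice_basis ?L d p b)"
  obtain p b where pb: "pb = (p, b)" by fastforce
  have "case pb of (p, b) \<Rightarrow> affine_lattice_basis ?L d p b"
    unfolding pb_def by (rule someI_ex) (use affine_lattice_basis_exists in auto)
  then have basis: "lin_indep d b" and L: "?L = {p + lincomb d b (\<lambda>i. of_int (a i)) | a :: nat \<Rightarrow> int. True}"
    by (auto simp: pb affine_lattice_basis_iff)
  have in_L: "p + lincomb d b (\<lambda>i. of_int (a i)) \<in> ?L" for a :: "nat \<Rightarrow> int"
    unfolding L by blast
  have p: "p \<in> affine hull c" "p \<in> integer_points"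
    using in_L[of "\<lambda>_. 0"] by auto
  have diff: "x - y \<in> range (lincomb d w)" if "x \<in> affine hull c" "y \<in> affine hull c" for x y
  proof -
    have "x - v0 \<in> span (w ` {..<d})" "y - v0 \<in> span (w ` {..<d})"
      using that by (auto simp: affine_hull_c span_image_lessThan)
    from span_diff[OF this] show ?thesis by (simp add: span_image_lessThan)
  qed
  have b_in: "b i \<in> range (lincomb d w)" "b i \<in> integer_points" if i: "i < d" for i
  proof -
    have "(\<lambda>j. real_of_int (if j = i then 1 else 0)) = (\<lambda>j. if j = i then 1 else 0)" by auto
    then have pbi: "p + b i \<in> ?L"
      using in_L[of "\<lambda>j. if j = i then 1 else 0"] lincomb_unit[OF i, of b] by simp
    show "b i \<in> range (lincomb d w)" using diff[of "p + b i" p] pbi p by simp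
    show "b i \<in> integer_points" using integer_points_diff[of "p + b i" p] pbi p by simp
  qed
  have w_in: "w i \<in> range (lincomb d b)" if "i < d" for i
  proof -
    have "h i \<in> ?L" "v0 \<in> ?L"
      using h_image that v0 integral hull_subset[of c affine] by blast+
    then obtain a a' :: "nat \<Rightarrow> int" where "h i = p + lincomb d b (\<lambda>i. of_int (a i))"
      "v0 = p + lincomb d b (\<lambda>i. of_int (a' i))"
      unfolding L by blast
    then have "w i = lincomb d b (\<lambda>i. of_int (a i) - of_int (a' i))"
      unfolding w_def lincomb_diff by simp
    then show ?thesis by blast
  qed
  have range_eq: "range (lincomb d b) = range (lincomb d w)"
    by (intro equalityI range_lincomb_subset b_in(1) w_in)
  have lattice: "\<exists>a::nat \<Rightarrow> int. x = lincomb d b (\<lambda>i. of_int (a i))"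
    if x: "x \<in> range (lincomb d w)" "x \<in> integer_points" for x
  proof -
    have "p - v0 \<in> span (w ` {..<d})"
      using p(1) by (auto simp: affine_hull_c span_image_lessThan)
    from span_add[OF this, of x] x(1) have "p + x - v0 \<in> range (lincomb d w)"
      by (simp add: span_image_lessThan algebra_simps)
    then have "p + x \<in> affine hull c"
      unfolding affine_hull_c by (intro image_eqI[of _ _ "p + x - v0"]) simp_all
    then have "p + x \<in> ?L" using p(2) x(2) by (simp add: integer_points_add)
    then show ?thesis unfolding L by auto
  qed
  have e: "p - v0 \<in> range (lincomb d w)"
    by (rule diff[OF p(1) hull_inc[OF v0]])
  have "nat (aff_dim (convex hull c)) = d"
    using aff_dim_affine_independent[OF affine_indep] by (simp add: aff_dim_convex_hull card_c)
  then have "lattice_volume (convex hull c) = fact d * measure (affine_lebesgue d p b) (convex hull c)"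
    unfolding lattice_volume_def by (simp add: pb pb_def[symmetric] affine_hull_convex_hull)
  also have "measure (affine_lebesgue d p b) (convex hull c) =
      measure (leb d) (affine_param d p b -` (convex hull c) \<inter> space (leb d))"
    unfolding affine_lebesgue_def using finite_c
    by (intro measure_distr affine_param_measurable)
      (simp add: borel_compact compact_convex_hull finite_imp_compact)
  also have "affine_param d p b -` (convex hull c) \<inter> space (leb d) =
      {t \<in> coords d. \<exists>x. (p - v0) + lincomb d b t = lincomb d w x \<and> (\<forall>i<d. 0 \<le> x i) \<and> (\<Sum>i<d. x i) \<le> 1}"
  proof -
    have "affine_param d p b t = v0 + ((p - v0) + lincomb d b t)" for t
      by (simp add: affine_param_eq)
    then have "affine_param d p b t \<in> convex hull c \<longleftrightarrow>
      (\<exists>x. (p - v0) + lincomb d b t = lincomb d w x \<and> (\<forall>i<d. 0 \<le> x i) \<and> (\<Sum>i<d. x i) \<le> 1)" for t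
      using convex_hull_c by presburger
    then show ?thesis by (auto simp: space_leb)
  qed
  finally show ?thesis
    using measure_simplex_coords[OF lin_indep_w w_integral basis b_in(2) range_eq lattice e] by simp
qed

text \<open>Forgetting the value at \<open>v0\<close> is injective: with the other values fixed, the
  integral total determines it modulo 1, and it lies in [0, 1).\<close>

lemma bij_betw_box_points:
  "bij_betw (\<lambda>u. restrict (\<lambda>i. u (h i)) {..<d}) (box_points c)
     {x \<in> unit_cube d. lincomb d w x \<in> integer_points}"
proof (rule bij_betwI')
  have v0_int: "v0 \<in> integer_points" using v0 integral by blast
  show "restrict (\<lambda>i. u (h i)) {..<d} \<in> {x \<in> unit_cube d. lincomb d w x \<in> integer_points}"
    if u: "u \<in> box_points c" for u
  proof -
    have "lincomb d w (\<lambda>i. u (h i)) = (\<Sum>v\<in>c. u v *\<^sub>R v) - sum u c *\<^sub>R v0"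
      unfolding sum_scaled_c by simp
    also have "\<dots> \<in> integer_points"
      using u v0_int by (intro integer_points_diff integer_points_scale) (auto simp: box_points_def)
    finally show ?thesis using u by (auto simp: lincomb_restrict box_points_def)
  qed
  show "restrict (\<lambda>i. u (h i)) {..<d} = restrict (\<lambda>i. u' (h i)) {..<d} \<longleftrightarrow> u = u'"
    if u: "u \<in> box_points c" and u': "u' \<in> box_points c" for u u'
  proof
    assume eq: "restrict (\<lambda>i. u (h i)) {..<d} = restrict (\<lambda>i. u' (h i)) {..<d}"
    have eq_h: "u (h i) = u' (h i)" if "i < d" for i
      using fun_cong[OF eq, of i] that by simp
    have "sum u c - sum u' c = u v0 - u' v0"
      using eq_h by (simp add: sum_c)
    moreover have "sum u c - sum u' c \<in> \<int>"
      using u u' by (auto simp: box_points_def)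
    ultimately have "u v0 - u' v0 \<in> \<int>" by simp
    then obtain k where k: "u v0 - u' v0 = of_int k" by (auto elim: Ints_cases)
    have "0 \<le> u v0" "u v0 < 1" "0 \<le> u' v0" "u' v0 < 1"
      using u u' by (auto simp: box_points_def)
    with k have "k = 0" by linarith
    show "u = u'"
    proof
      fix v
      consider "v = v0" | "v \<in> c - {v0}" | "v \<notin> c" by blast
      then show "u v = u' v"
      proof cases
        case 1
        with k \<open>k = 0\<close> show ?thesis by simp
      next
        case 2
        then show ?thesis using eq_h h_image by (metis image_iff lessThan_iff)
      next
        case 3
        then show ?thesis using u u' by (simp add: box_points_def)
      qed
    qed
  qed simp
  show "\<exists>u\<in>box_points c. x = restrict (\<lambda>i. u (h i)) {..<d}"
    if x: "x \<in> {x \<in> unit_cube d. lincomb d w x \<in> integer_points}" for x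
  proof -
    have xi: "0 \<le> x i" "x i < 1" if "i < d" for i
      using x that by (auto simp: PiE_iff)
    \<comment> \<open>\<open>frac (- s)\<close> is the only number in [0, 1) that completes the sum
      \<open>s\<close> of the other coefficients to an integer.\<close>
    define u where "u v = (if v = v0 then frac (- (\<Sum>i<d. x i))
      else if v \<in> c then x (the_inv_into {..<d} h v) else 0)" for v
    have u: "u (h i) = x i" if "i < d" for i
      using that h_image by (auto simp: u_def the_inv_into_f_f[OF inj_h])
    have sum_u: "sum u c = of_int (- \<lfloor>- (\<Sum>i<d. x i)\<rfloor>)"
      using u by (simp add: sum_c u_def[of v0] frac_def)
    then have "sum u c \<in> \<int>" by (simp only: Ints_of_int)
    moreover have "(\<Sum>v\<in>c. u v *\<^sub>R v) \<in> integer_points"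
      unfolding sum_scaled_c using x u v0_int \<open>sum u c \<in> \<int>\<close>
      by (intro integer_points_add integer_points_scale) (auto cong: lincomb_cong)
    moreover have "0 \<le> u v \<and> u v < 1" for v
    proof -
      consider "v = v0" | "v \<in> c - {v0}" | "v \<notin> c" by blast
      then show ?thesis
      proof cases
        case 1
        then show ?thesis by (simp add: u_def frac_ge_0 frac_lt_1)
      next
        case 2
        then have "v \<in> h ` {..<d}" by (simp add: h_image)
        then obtain i where "i < d" "v = h i" by auto
        then show ?thesis using u xi by simp
      next
        case 3
        then show ?thesis using v0 by (auto simp: u_def)
      qed
    qed
    moreover have "u v = 0" if "v \<notin> c" for v using that v0 by (auto simp: u_def)
    ultimately have "u \<in> box_points c" unfolding box_points_def by blast
    moreover have "x = restrict (\<lambda>i. u (h i)) {..<d}"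
      using x u by (intro PiE_ext[where k = "{..<d}" and s = "\<lambda>_. {0..<1}"]) (auto simp: xi)
    ultimately show ?thesis by blast
  qed
qed

end

lemma
  fixes c :: "(real ^ 'n) set"
  assumes "c \<subseteq> integer_points" "\<not> affine_dependent c" "c \<noteq> {}"
  shows finite_box_points: "finite (box_points c)"
    and lattice_volume_eq_card: "lattice_volume (convex hull c) = card (box_points c)"
proof -
  have fin: "finite c" using assms(2) aff_independent_finite by blast
  obtain v0 where v0: "v0 \<in> c" using assms(3) by blast
  obtain h where "bij_betw h {..<card (c - {v0})} (c - {v0})"
    using ex_bij_betw_nat_finite[of "c - {v0}"] fin by (auto simp: atLeast0LessThan)
  then interpret lattice_simplex_chart c v0 "card (c - {v0})" h
    using assms fin v0 by unfold_locales
  show "finite (box_points c)"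
    using bij_betw_finite[OF bij_betw_box_points] finite_cube_lattice_points[OF lin_indep_w] by blast
  show "lattice_volume (convex hull c) = card (box_points c)"
    unfolding lattice_volume_eq_card_cube bij_betw_same_card[OF bij_betw_box_points] ..
qed

section \<open>Faces as vertex sets and the double count\<close>

lemma faces_of_dim_simplex:
  fixes V :: "(real ^ 'n) set"
  assumes "\<not> affine_dependent V"
  shows "faces_of_dim (convex hull V) j = (hull) convex ` {c. c \<subseteq> V \<and> card c = j + 1}"
proof -
  have "aff_dim (convex hull c) = int j \<longleftrightarrow> card c = j + 1" if "c \<subseteq> V" for c
    using aff_dim_affine_independent[of c] affine_independent_subset[OF assms that]
    by (auto simp: aff_dim_convex_hull)
  then show ?thesis
    unfolding faces_of_dim_def face_of_convex_hull_affine_independent[OF assms] by blast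
qed

text \<open>The extreme points of a face recover its vertices, so a sum over faces can be taken over
  vertex sets.\<close>

lemma inj_on_convex_hull_affine_independent:
  fixes V :: "'a::euclidean_space set"
  assumes "\<not> affine_dependent V"
  shows "inj_on ((hull) convex) (Pow V)"
proof (rule inj_onI)
  fix c c' assume c: "c \<in> Pow V" "c' \<in> Pow V" "convex hull c = convex hull c'"
  have extreme: "x extreme_point_of convex hull c \<longleftrightarrow> x \<in> c" if "c \<in> Pow V" for c x
    using affine_independent_subset[OF assms] that
    by (intro extreme_point_of_convex_hull_affine_independent) auto
  show "c = c'"
    using extreme[OF c(1)] extreme[OF c(2)] unfolding c(3) by (intro set_eqI) simp
qed

text \<open>For a face with vertex set \<open>c\<close> and dimension j, the weight j + 1 is
  \<open>card c\<close> and the exponent n - j is \<open>card (V - c)\<close>; both depend on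
  \<open>c\<close> alone, which permits the exchange of sums.\<close>

lemma c_invariant_simplex:
  fixes V :: "(real ^ 'n) set"
  assumes V: "V \<subseteq> integer_points" "\<not> affine_dependent V" "V \<noteq> {}"
  shows "c_invariant (convex hull V) =
    (\<Sum>u\<in>box_points V. \<Sum>c | {v. u v \<noteq> 0} \<subseteq> c \<and> c \<subseteq> V. (-1) ^ card (V - c) * real (card c))"
proof -
  let ?g = "\<lambda>c. (-1) ^ card (V - c) * real (card c)"
  let ?G = "\<lambda>c. ?g c * real (card (box_points c))"
  have fin: "finite V" using V(2) aff_independent_finite by blast
  define n where "n = card V - 1"
  have card_V: "card V = n + 1" using V(3) fin by (simp add: n_def card_gt_0_iff)
  have "nat (aff_dim (convex hull V)) = n"
    using aff_dim_affine_independent[OF V(2)] by (simp add: aff_dim_convex_hull card_V)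
  then have "c_invariant (convex hull V) = (\<Sum>j=0..n. (-1) ^ (n - j) * real (j + 1) *
      (\<Sum>F\<in>faces_of_dim (convex hull V) j. lattice_volume F))"
    by (simp add: c_invariant_def)
  \<comment> \<open>The empty set is excluded because truncated subtraction would give it dimension
    0, like a vertex.\<close>
  also have "\<dots> = (\<Sum>j=0..n. \<Sum>c | c \<in> Pow V - {{}} \<and> card c - 1 = j. ?G c)"
  proof (intro sum.cong refl)
    fix j assume j: "j \<in> {0..n}"
    have sets: "{c. c \<in> Pow V - {{}} \<and> card c - 1 = j} = {c. c \<subseteq> V \<and> card c = j + 1}"
    proof -
      have "c \<in> Pow V - {{}} \<and> card c - 1 = j \<longleftrightarrow> c \<subseteq> V \<and> card c = j + 1" for c
      proof (cases "c \<subseteq> V")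
        case True
        then have "card c = 0 \<longleftrightarrow> c = {}" using finite_subset[OF True fin] by simp
        with True show ?thesis by (cases "card c") auto
      qed simp
      then show ?thesis by simp
    qed
    have "inj_on ((hull) convex) {c. c \<subseteq> V \<and> card c = j + 1}"
      by (rule inj_on_subset[OF inj_on_convex_hull_affine_independent[OF V(2)]]) auto
    then have "(\<Sum>F\<in>faces_of_dim (convex hull V) j. lattice_volume F) =
        (\<Sum>c | c \<subseteq> V \<and> card c = j + 1. lattice_volume (convex hull c))"
      unfolding faces_of_dim_simplex[OF V(2)] by (simp only: sum.reindex o_def)
    also have "\<dots> = (\<Sum>c | c \<subseteq> V \<and> card c = j + 1. real (card (box_points c)))"
    proof (intro sum.cong refl lattice_volume_eq_card)
      fix c assume "c \<in> {c. c \<subseteq> V \<and> card c = j + 1}"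
      then show "c \<subseteq> integer_points" "\<not> affine_dependent c" "c \<noteq> {}"
        using V affine_independent_subset[OF V(2), of c] by auto
    qed
    also have "(-1) ^ (n - j) * real (j + 1) * \<dots> = (\<Sum>c | c \<subseteq> V \<and> card c = j + 1. ?G c)"
      unfolding sum_distrib_left
    proof (intro sum.cong refl)
      fix c assume c: "c \<in> {c. c \<subseteq> V \<and> card c = j + 1}"
      then have "card (V - c) = n - j"
        using fin card_V by (subst card_Diff_subset) (auto intro: finite_subset)
      with c show "(-1) ^ (n - j) * real (j + 1) * real (card (box_points c)) = ?G c" by simp
    qed
    finally show "(-1) ^ (n - j) * real (j + 1) * (\<Sum>F\<in>faces_of_dim (convex hull V) j. lattice_volume F) =
        (\<Sum>c | c \<in> Pow V - {{}} \<and> card c - 1 = j. ?G c)"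
      unfolding sets .
  qed
  also have "\<dots> = sum ?G (Pow V - {{}})"
  proof (rule sum.group)
    show "(\<lambda>c. card c - 1) ` (Pow V - {{}}) \<subseteq> {0..n}"
    proof (rule image_subsetI)
      fix c assume "c \<in> Pow V - {{}}"
      then have "card c \<le> n + 1" using card_mono[OF fin, of c] card_V by simp
      then show "card c - 1 \<in> {0..n}" by simp
    qed
  qed (use fin in auto)
  \<comment> \<open>The empty set may return, as its weight \<open>card c\<close> is 0; the sum then
    runs over all subsets, as the alternating sums require.\<close>
  also have "\<dots> = sum ?G (Pow V)"
    using fin by (intro sum.mono_neutral_left) auto
  also have "\<dots> = (\<Sum>c\<in>Pow V. \<Sum>u | u \<in> box_points V \<and> {v. u v \<noteq> 0} \<subseteq> c. ?g c)"
  proof (intro sum.cong refl)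
    fix c assume "c \<in> Pow V"
    then have "box_points c = {u. u \<in> box_points V \<and> {v. u v \<noteq> 0} \<subseteq> c}"
      by (intro box_points_subset[OF fin]) simp
    then show "?G c = (\<Sum>u | u \<in> box_points V \<and> {v. u v \<noteq> 0} \<subseteq> c. ?g c)"
      by (simp only: sum_constant mult.commute)
  qed
  also have "\<dots> = (\<Sum>u\<in>box_points V. \<Sum>c | c \<in> Pow V \<and> {v. u v \<noteq> 0} \<subseteq> c. ?g c)"
    using fin finite_box_points[OF V] by (intro sum.swap_restrict) auto
  also have "\<dots> = (\<Sum>u\<in>box_points V. \<Sum>c | {v. u v \<noteq> 0} \<subseteq> c \<and> c \<subseteq> V. ?g c)"
    by (intro sum.cong refl Collect_cong) auto
  finally show ?thesis .
qed

theorem proposition3p2: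
  fixes P :: "(real ^ 'n) set"
  assumes "CARD('n) \<ge> 2"
    and "lattice_simplex P"
  shows "c_invariant P \<ge> 0"
proof -
  obtain V where V: "V \<subseteq> integer_points" "\<not> affine_dependent V" "card V = CARD('n) + 1"
    and P: "P = convex hull V"
    using assms(2) by (auto simp: lattice_simplex_def)
  then have "V \<noteq> {}" "finite V" using aff_independent_finite by auto
  moreover have "{v. u v \<noteq> 0} \<subseteq> V" if "u \<in> box_points V" for u
    using that by (auto simp: box_points_def)
  ultimately show ?thesis
    unfolding P c_invariant_simplex[OF V(1,2) \<open>V \<noteq> {}\<close>]
    by (intro sum_nonneg sum_supersets_alternating_card_nonneg) auto
qed

end
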